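(* Let $P(x,y):=xy$, let $\mathcal{L}$ be the Lebesgue measure on $\mathbb{R}$, and let $\mathcal{D}_3$ be the third step of the fast subdivision (defined in the context). Then $$ \bigg|\mathcal{L}\big(P(\mathcal{D}_3\times\mathcal{D}_3)\big)-\frac{91782451}{170061120}\bigg|\leq\frac{1}{64\cdot9^6}. $$
   Context: For a closed interval $I=[a,b]$ with $a<b$, let $A_I:[0,1]\to I$, $A_I(x):=a+(b-a)x$. Let $\mathcal{B}\subset(0,1)$ be the disjoint union of open intervals $$ \mathcal{B}:=\Big(\bigcup_{k\geq1}\Big(\tfrac{1}{3^{k+1}},\tfrac{2}{3^{k+1}}\Big)\Big)\cup\Big(\tfrac13,\tfrac23\Big)\cup\Big(\bigcup_{k\geq1}\Big(\tfrac{3^{k+1}-2}{3^{k+1}},\tfrac{3^{k+1}-1}{3^{k+1}}\Big)\Big). $$ For a set $\mathcal{S}\subset[0,1]$ which is a union of countably many points and countably many intervals, let $\mathcal{E}(\mathcal{S})$ be the family of connected components of $\mathcal{S}$ with non-empty interior. The fast subdivision is defined by $\mathcal{D}_0:=[2/3,1]$ and, for $n\geq1$, $$ \mathcal{D}_n:=\mathcal{D}_{n-1}\setminus\bigcup_{I\in\mathcal{E}(\mathcal{D}_{n-1})}A_I(\mathcal{B}). $$ *)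

theory Defs
  imports "HOL-Analysis.Analysis"
begin

definition affine_onto :: "real set \<Rightarrow> real \<Rightarrow> real" where
  "affine_onto I x = Inf I + (Sup I - Inf I) * x"

definition gaps :: "real set" where
  "gaps =
     (\<Union>k\<in>{k::nat. k \<ge> 1}. {1 / 3 ^ (k + 1) <..< 2 / 3 ^ (k + 1)})
     \<union> {1 / 3 <..< 2 / 3}
     \<union> (\<Union>k\<in>{k::nat. k \<ge> 1}.
          {(3 ^ (k + 1) - 2) / 3 ^ (k + 1) <..< (3 ^ (k + 1) - 1) / 3 ^ (k + 1)})"

definition solid_components :: "real set \<Rightarrow> real set set" where
  "solid_components S = {C \<in> components S. interior C \<noteq> {}}"

text \<open>
  The components with non-empty interior that occur below are non-degenerate compact
  intervals \<open>[a, b]\<close>, so their infimum and supremum are the end points \<open>a\<close> and \<open>b\<close>.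
\<close>

primrec fast_subdivision :: "nat \<Rightarrow> real set" where
  "fast_subdivision 0 = {2 / 3 .. 1}"
| "fast_subdivision (Suc n) =
     fast_subdivision n - (\<Union>I\<in>solid_components (fast_subdivision n). affine_onto I ` gaps)"

end

theory Submission
  imports Defs
begin

text \<open>
  For a node \<open>[a, a + s]\<close> of the ternary tree, the products of the left with the right third of
  the Cantor set in it fill a whole interval, which ends at distance \<open>s\<^sup>2 / 9\<close> below the
  products of two points of the right third.  Hence the complement of the product set in
  \<open>[4 / 9, 1]\<close> consists of the gaps of the subdivided nodes, up to those gaps that are filled by
  the two thirds of another node.  A node of length \<open>s\<close> fills gaps only in a part of length
  about \<open>s\<^sup>2 / 9\<close> at the right end of its left third, so that the filled gaps amount to
  \<open>O(s\<^sup>4)\<close>: the root and its two children account for them up to the claimed error.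
\<close>

section \<open>Holes and gaps in the ternary tree\<close>

text \<open>The third step contains the left ends of all nodes of the ternary tree over
  \<open>[2 / 3, 1]\<close>, subdivided or not. Filled intervals can therefore be established with
  these points alone; the states matter only for the gaps. The obstacle is that gaps arise, and may
  be refilled, at infinitely many depths. Their total measure is nevertheless exact: gaps of
  different nodes are disjoint and states repeat along a run, so a linear recursion determines it.
  Only the refilled part has to be estimated. In units of \<open>1 / 170061120\<close>, the interval
  \<open>[4 / 9, 1]\<close> without its gaps has measure 91779075. The root refills 3290 units and
  each of its two children at least 40.6, while the tolerance amounts to 5 units. This is why two
  levels are treated by hand and everything deeper only by a crude cover.\<close>

datatype run = Fresh | Zeros | Twos

text \<open>
  A node of the ternary tree is an interval \<open>[a, a + s]\<close>, with children its left and right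
  thirds.  One step of the fast subdivision removes the middle thirds along the paths
  \<open>0\<dots>0\<close> and \<open>2\<dots>2\<close>, and its solid components are the nodes where such a run is
  interrupted.  A state records the number of steps still to be carried out and the current run;
  a node is subdivided as long as that number is positive.
\<close>
type_synonym state = "nat \<times> run"

fun lchild :: "state \<Rightarrow> state" where
  "lchild (0, q) = (0, q)"
| "lchild (Suc n, Fresh) = (Suc n, Zeros)"
| "lchild (Suc n, Zeros) = (Suc n, Zeros)"
| "lchild (Suc n, Twos) = (n, Fresh)"

fun rchild :: "state \<Rightarrow> state" where
  "rchild (0, q) = (0, q)"
| "rchild (Suc n, Fresh) = (Suc n, Twos)"
| "rchild (Suc n, Zeros) = (n, Fresh)"
| "rchild (Suc n, Twos) = (Suc n, Twos)"

text \<open>Holes, gaps, filled intervals and late gaps are all existence statements over the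
  subdivided nodes below a given one; a single predicate gives them a common induction on the depth
  of the witness. Testing \<open>0 < fst \<sigma>\<close> at the witness suffices, since dead states
  have only dead descendants.\<close>

inductive occurs :: "(state \<Rightarrow> real \<Rightarrow> real \<Rightarrow> bool) \<Rightarrow> state \<Rightarrow> real \<Rightarrow> real \<Rightarrow> bool"
  for Q where
  here: "0 < fst \<sigma> \<Longrightarrow> Q \<sigma> a s \<Longrightarrow> occurs Q \<sigma> a s"
| left: "occurs Q (lchild \<sigma>) a (s / 3) \<Longrightarrow> occurs Q \<sigma> a s"
| right: "occurs Q (rchild \<sigma>) (a + 2 * s / 3) (s / 3) \<Longrightarrow> occurs Q \<sigma> a s"

lemma alive_lchild: "0 < fst (lchild \<sigma>) \<Longrightarrow> 0 < fst \<sigma>"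
  by (cases \<sigma> rule: lchild.cases) auto

lemma alive_rchild: "0 < fst (rchild \<sigma>) \<Longrightarrow> 0 < fst \<sigma>"
  by (cases \<sigma> rule: rchild.cases) auto

lemma occurs_alive: "occurs Q \<sigma> a s \<Longrightarrow> 0 < fst \<sigma>"
  by (induction rule: occurs.induct) (auto dest: alive_lchild alive_rchild)

lemma occurs_iff:
  "occurs Q \<sigma> a s \<longleftrightarrow> 0 < fst \<sigma> \<and> (Q \<sigma> a s \<or> occurs Q (lchild \<sigma>) a (s / 3)
     \<or> occurs Q (rchild \<sigma>) (a + 2 * s / 3) (s / 3))"
proof
  assume "occurs Q \<sigma> a s"
  then show "0 < fst \<sigma> \<and> (Q \<sigma> a s \<or> occurs Q (lchild \<sigma>) a (s / 3)
     \<or> occurs Q (rchild \<sigma>) (a + 2 * s / 3) (s / 3))"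
    by cases (auto dest: occurs_alive alive_lchild alive_rchild)
qed (auto intro: occurs.intros)

definition hole :: "state \<Rightarrow> real \<Rightarrow> real \<Rightarrow> real \<Rightarrow> bool" where
  "hole \<sigma> a s x = occurs (\<lambda>_ a s. a + s / 3 < x \<and> x < a + 2 * s / 3) \<sigma> a s"

text \<open>
  The products of two points of \<open>[a, a + s]\<close> outside the open middle third, with at least one
  factor in the left third, are at most \<open>(a + s / 3) * (a + s)\<close>; all others are at least
  \<open>(a + 2 * s / 3)\<^sup>2\<close>.
\<close>
definition gap :: "state \<Rightarrow> real \<Rightarrow> real \<Rightarrow> real \<Rightarrow> bool" where
  "gap \<sigma> a s z = occurs (\<lambda>_ a s. (a + s / 3) * (a + s) < z \<and> z < (a + 2 * s / 3)\<^sup>2) \<sigma> a s"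

lemma hole_iff:
  "hole \<sigma> a s x \<longleftrightarrow> 0 < fst \<sigma> \<and> (a + s / 3 < x \<and> x < a + 2 * s / 3
     \<or> hole (lchild \<sigma>) a (s / 3) x \<or> hole (rchild \<sigma>) (a + 2 * s / 3) (s / 3) x)"
  unfolding hole_def by (subst occurs_iff) simp

lemma gap_iff:
  "gap \<sigma> a s z \<longleftrightarrow> 0 < fst \<sigma> \<and> ((a + s / 3) * (a + s) < z \<and> z < (a + 2 * s / 3)\<^sup>2
     \<or> gap (lchild \<sigma>) a (s / 3) z \<or> gap (rchild \<sigma>) (a + 2 * s / 3) (s / 3) z)"
  unfolding gap_def by (subst occurs_iff) simp

lemma hole_bounds: "hole \<sigma> a s x \<Longrightarrow> a < x \<and> x < a + s"
  unfolding hole_def by (induction rule: occurs.induct) linarith+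

lemma gap_bounds:
  assumes "gap \<sigma> a s z" "0 \<le> a" "0 < s"
  shows "a\<^sup>2 < z \<and> z < (a + s)\<^sup>2"
  using assms unfolding gap_def
proof (induction rule: occurs.induct)
  case (here \<sigma> a s)
  have "a * a \<le> (a + s / 3) * (a + s)" by (rule mult_mono) (use here in auto)
  moreover have "(a + 2 * s / 3)\<^sup>2 \<le> (a + s)\<^sup>2" by (rule power_mono) (use here in auto)
  ultimately show ?case using here by (simp add: power2_eq_square)
next
  case (left \<sigma> a s)
  have "(a + s / 3)\<^sup>2 \<le> (a + s)\<^sup>2" by (rule power_mono) (use left in auto)
  moreover have "a\<^sup>2 < z \<and> z < (a + s / 3)\<^sup>2" using left by simp
  ultimately show ?case by linarith
next
  case (right \<sigma> a s)
  have "a\<^sup>2 \<le> (a + 2 * s / 3)\<^sup>2" by (rule power_mono) (use right in auto)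
  moreover have "a + 2 * s / 3 + s / 3 = a + s" by simp
  moreover have "(a + 2 * s / 3)\<^sup>2 < z \<and> z < (a + 2 * s / 3 + s / 3)\<^sup>2" using right by simp
  moreover have "a + 2 * s / 3 + s / 3 = a + s" by simp
  ultimately show ?case by (metis order_le_less_trans)
qed

text \<open>For holes this makes the surviving set compact, for gaps it gives measurability.\<close>

lemma open_occurs:
  assumes "\<And>\<sigma> a s. open {x. Q x \<sigma> a s}"
  shows "open {x :: 'a :: topological_space. occurs (Q x) \<sigma> a s}"
proof -
  have "\<exists>T. open T \<and> x \<in> T \<and> (\<forall>y\<in>T. occurs (Q y) \<sigma> a s)" if "occurs (Q x) \<sigma> a s" for x
    using that
  proof (induction rule: occurs.induct)
    case (here \<sigma> a s)
    then show ?case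
      by (intro exI[of _ "{x. Q x \<sigma> a s}"]) (auto simp: assms intro: occurs.here)
  next
    case (left \<sigma> a s)
    then obtain T where "open T" "x \<in> T" "\<forall>y\<in>T. occurs (Q y) (lchild \<sigma>) a (s / 3)"
      by blast
    then show ?case by (intro exI[of _ T]) (simp add: occurs.left)
  next
    case (right \<sigma> a s)
    then obtain T where "open T" "x \<in> T"
      "\<forall>y\<in>T. occurs (Q y) (rchild \<sigma>) (a + 2 * s / 3) (s / 3)"
      by blast
    then show ?case by (intro exI[of _ T]) (simp add: occurs.right)
  qed
  then show ?thesis by (subst open_subopen) (simp add: subset_iff Ball_def)
qed

lemma open_hole: "open {x. hole \<sigma> a s x}"
  unfolding hole_def
  by (rule open_occurs) (intro open_Collect_conj open_Collect_less continuous_on_const continuous_on_id)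

lemma open_gap: "open {z. gap \<sigma> a s z}"
  unfolding gap_def
  by (rule open_occurs) (intro open_Collect_conj open_Collect_less continuous_on_const continuous_on_id)

text \<open>The solution of the recursion in \<open>weight_rec\<close> below.\<close>
fun fresh_weight :: "nat \<Rightarrow> real" where
  "fresh_weight 0 = 0"
| "fresh_weight (Suc n) = (5 + fresh_weight n) / 36"

fun weight :: "state \<Rightarrow> real" where
  "weight (0, _) = 0"
| "weight (n, Fresh) = fresh_weight n"
| "weight (Suc n, _) = (1 + fresh_weight n) / 8"

text \<open>The value \<open>1 / 7\<close> solves \<open>w = (1 + 2 * w) / 9\<close>, the equation
  of a node subdivided without end.\<close>

lemma fresh_weight_bounds: "0 \<le> fresh_weight n" "fresh_weight n \<le> 1 / 7"
  by (induction n) auto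

lemma weight_bounds: "0 \<le> weight \<sigma>" "weight \<sigma> \<le> 1 / 7"
proof (atomize (full), cases \<sigma>)
  case (Pair n q)
  then show "0 \<le> weight \<sigma> \<and> weight \<sigma> \<le> 1 / 7"
    using fresh_weight_bounds[of n] fresh_weight_bounds[of "n - 1"]
    by (cases n; cases q) (auto simp del: fresh_weight.simps(2))
qed

text \<open>Inside a run one child keeps the state, so the recursion reads
  \<open>w = (1 + w + fresh_weight n) / 9\<close> with solution
  \<open>(1 + fresh_weight n) / 8\<close>. Two children of this weight give
  \<open>(5 + fresh_weight n) / 36\<close> for a fresh node.\<close>

lemma weight_rec:
  assumes "0 < fst \<sigma>"
  shows "weight \<sigma> = (1 + weight (lchild \<sigma>) + weight (rchild \<sigma>)) / 9"
proof -
  have *: "weight (n, Fresh) = fresh_weight n" for n by (cases n) auto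
  obtain n q where "\<sigma> = (Suc n, q)" using assms by (metis gr0_implies_Suc prod.collapse)
  then show ?thesis by (cases q) (auto simp: *)
qed

section \<open>The measure of the gap set of a node\<close>

lemma gap_set_iff:
  assumes "0 < fst \<sigma>"
  shows "{z. gap \<sigma> a s z} = {(a + s / 3) * (a + s) <..< (a + 2 * s / 3)\<^sup>2}
    \<union> {z. gap (lchild \<sigma>) a (s / 3) z} \<union> {z. gap (rchild \<sigma>) (a + 2 * s / 3) (s / 3) z}"
  using assms by (subst gap_iff) auto

lemma gap_subset:
  assumes "0 \<le> a" "0 < s"
  shows "{z. gap \<sigma> a s z} \<subseteq> {a\<^sup>2 .. (a + s)\<^sup>2}"
proof
  fix z
  assume "z \<in> {z. gap \<sigma> a s z}"
  then have "a\<^sup>2 < z \<and> z < (a + s)\<^sup>2" by (intro gap_bounds assms) simp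
  then show "z \<in> {a\<^sup>2 .. (a + s)\<^sup>2}" by simp
qed

lemma lmeasurable_gap:
  assumes "0 \<le> a" "0 < s"
  shows "{z. gap \<sigma> a s z} \<in> lmeasurable"
  using gap_subset[OF assms] bounded_closed_interval bounded_subset
  by (intro lmeasurable_open open_gap) blast

lemma gap_length: "((a::real) + 2 * s / 3)\<^sup>2 - (a + s / 3) * (a + s) = s\<^sup>2 / 9"
  by (simp add: power2_eq_square field_simps)

lemma measure_gap_Un_right:
  assumes "0 \<le> a" "0 < s"
  shows "measure lebesgue ({(a + s / 3) * (a + s) <..< (a + 2 * s / 3)\<^sup>2}
      \<union> {z. gap \<sigma> (a + 2 * s / 3) (s / 3) z})
    = s\<^sup>2 / 9 + measure lebesgue {z. gap \<sigma> (a + 2 * s / 3) (s / 3) z}"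
proof -
  have "0 \<le> s\<^sup>2 / 9" by simp
  then have "(a + s / 3) * (a + s) \<le> (a + 2 * s / 3)\<^sup>2" using gap_length[of a s] by linarith
  moreover have "{(a + s / 3) * (a + s) <..< (a + 2 * s / 3)\<^sup>2}
      \<inter> {z. gap \<sigma> (a + 2 * s / 3) (s / 3) z} = {}"
    using gap_bounds[of \<sigma> "a + 2 * s / 3" "s / 3"] assms by fastforce
  ultimately show ?thesis
    using assms gap_length[of a s] lmeasurable_gap[of "a + 2 * s / 3" "s / 3" \<sigma>]
    by (subst measure_Un2) (auto simp: Diff_triv Int_commute)
qed

text \<open>The three parts are stacked: the gaps of the left child stay below
  \<open>(a + s / 3)^2\<close>, the middle gap starts no lower than that, and the gaps of the right
  child lie above \<open>(a + 2 * s / 3)^2\<close>.\<close>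

lemma measure_gap_rec:
  assumes "0 < fst \<sigma>" "0 \<le> a" "0 < s"
  shows "measure lebesgue {z. gap \<sigma> a s z} = s\<^sup>2 / 9
    + measure lebesgue {z. gap (lchild \<sigma>) a (s / 3) z}
    + measure lebesgue {z. gap (rchild \<sigma>) (a + 2 * s / 3) (s / 3) z}"
proof -
  let ?G = "{(a + s / 3) * (a + s) <..< (a + 2 * s / 3)\<^sup>2}"
  let ?L = "{z. gap (lchild \<sigma>) a (s / 3) z}"
  let ?R = "{z. gap (rchild \<sigma>) (a + 2 * s / 3) (s / 3) z}"
  have "(a + s / 3) * (a + s / 3) \<le> (a + s / 3) * (a + s)"
    using assms by (intro mult_left_mono) auto
  moreover have "(a + s / 3)\<^sup>2 \<le> (a + 2 * s / 3)\<^sup>2" by (rule power_mono) (use assms in auto)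
  ultimately have order: "(a + s / 3)\<^sup>2 \<le> (a + s / 3) * (a + s)"
    "(a + s / 3)\<^sup>2 \<le> (a + 2 * s / 3)\<^sup>2"
    by (auto simp: power2_eq_square)
  have "z < (a + s / 3)\<^sup>2" if "z \<in> ?L" for z
    using that assms gap_bounds[of "lchild \<sigma>" a "s / 3" z] by simp
  moreover have "(a + s / 3)\<^sup>2 < z" if "z \<in> ?G \<union> ?R" for z
  proof (cases "z \<in> ?G")
    case False
    then have "gap (rchild \<sigma>) (a + 2 * s / 3) (s / 3) z" using that by blast
    then have "(a + 2 * s / 3)\<^sup>2 < z" using assms gap_bounds by fastforce
    then show ?thesis using order(2) by linarith
  qed (use order(1) in simp)
  ultimately have "(?G \<union> ?R) \<inter> ?L = {}" by (meson disjoint_iff less_asym)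
  moreover have "{z. gap \<sigma> a s z} = (?G \<union> ?R) \<union> ?L"
    using gap_set_iff[OF assms(1)] by blast
  ultimately show ?thesis
    using assms measure_gap_Un_right[of a s] lmeasurable_gap[of a "s / 3"]
      lmeasurable_gap[of "a + 2 * s / 3" "s / 3"]
    by (simp add: measure_Un2 Diff_triv Int_commute fmeasurable.Un)
qed

text \<open>
  The self-similarity of the gap set determines its measure without summing a series: replacing the
  measure by \<open>weight \<sigma> * s\<^sup>2\<close> in both children shrinks the total error by \<open>2 / 3\<close>.
\<close>
lemma measure_gap_approx:
  assumes "0 \<le> a" "0 < s" "a + s \<le> 1"
  shows "\<bar>measure lebesgue {z. gap \<sigma> a s z} - weight \<sigma> * s\<^sup>2\<bar> \<le> 2 * s * (2 / 3) ^ d"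
  using assms
proof (induction d arbitrary: \<sigma> a s)
  case 0
  have "measure lebesgue {z. gap \<sigma> a s z} \<le> measure lebesgue {a\<^sup>2 .. (a + s)\<^sup>2}"
    using gap_subset[of a s \<sigma>] lmeasurable_gap[of a s \<sigma>] 0 by (intro measure_mono_fmeasurable) (auto simp: fmeasurableD)
  also have "\<dots> = s * (2 * a + s)"
    using 0 by (simp add: power2_eq_square algebra_simps)
  also have "\<dots> \<le> s * 2" using 0 by (intro mult_left_mono) auto
  finally have 1: "measure lebesgue {z. gap \<sigma> a s z} \<le> 2 * s" by simp
  have "weight \<sigma> * s\<^sup>2 \<le> 1 * s" using 0 weight_bounds[of \<sigma>]
    by (intro mult_mono) (auto simp: power2_eq_square mult_le_one)
  moreover have "0 \<le> weight \<sigma> * s\<^sup>2" using weight_bounds[of \<sigma>] by simp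
  ultimately show ?case using 1 0 measure_nonneg[of lebesgue "{z. gap \<sigma> a s z}"]
    by (simp del: measure_nonneg)
next
  case (Suc d)
  show ?case
  proof (cases "0 < fst \<sigma>")
    case True
    have L: "\<bar>measure lebesgue {z. gap (lchild \<sigma>) a (s / 3) z} - weight (lchild \<sigma>) * (s / 3)\<^sup>2\<bar>
        \<le> 2 * (s / 3) * (2 / 3) ^ d"
      by (rule Suc.IH) (use Suc.prems in auto)
    have R: "\<bar>measure lebesgue {z. gap (rchild \<sigma>) (a + 2 * s / 3) (s / 3) z}
        - weight (rchild \<sigma>) * (s / 3)\<^sup>2\<bar> \<le> 2 * (s / 3) * (2 / 3) ^ d"
      by (rule Suc.IH) (use Suc.prems in auto)
    have "weight \<sigma> * s\<^sup>2 = s\<^sup>2 / 9 + weight (lchild \<sigma>) * (s / 3)\<^sup>2 + weight (rchild \<sigma>) * (s / 3)\<^sup>2"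
      using weight_rec[OF True] by (simp add: power2_eq_square field_simps)
    moreover have "2 * s * (2 / 3) ^ Suc d = 2 * (2 * (s / 3) * (2 / 3) ^ d)" by simp
    ultimately show ?thesis using L R measure_gap_rec[OF True Suc.prems(1,2)] by linarith
  next
    case False
    then have "{z. gap \<sigma> a s z} = {}" using occurs_alive[of _ \<sigma> a s] by (auto simp: gap_def)
    moreover have "weight \<sigma> = 0" using False by (cases \<sigma>) auto
    ultimately show ?thesis using Suc.prems by simp
  qed
qed

lemma le_of_le_geometric:
  fixes x y c :: real
  assumes "\<And>d. x \<le> y + c * (2 / 3) ^ d"
  shows "x \<le> y"
proof (rule LIMSEQ_le_const)
  have "(\<lambda>d. y + c * (2 / 3) ^ d) \<longlonglongrightarrow> y + c * 0"
    by (intro tendsto_intros LIMSEQ_realpow_zero) auto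
  then show "(\<lambda>d. y + c * (2 / 3) ^ d) \<longlonglongrightarrow> y" by simp
qed (use assms in auto)

lemma measure_gap:
  assumes "0 \<le> a" "0 < s" "a + s \<le> 1"
  shows "measure lebesgue {z. gap \<sigma> a s z} = weight \<sigma> * s\<^sup>2"
  using le_of_le_geometric[of "\<bar>measure lebesgue {z. gap \<sigma> a s z} - weight \<sigma> * s\<^sup>2\<bar>" 0 "2 * s"]
    measure_gap_approx[OF assms] by auto

section \<open>The fast subdivision as a complement of holes\<close>

text \<open>The nodes with relative addresses 0...02 and 2...20, where the run has
  \<open>k + 1\<close> digits, given by left end and length.\<close>

definition kids :: "real \<Rightarrow> real \<Rightarrow> (real \<times> real) set" where
  "kids a s = range (\<lambda>k. (a + 2 * s / 3 ^ (k + 2), s / 3 ^ (k + 2)))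
    \<union> range (\<lambda>k. (a + s - s / 3 ^ (k + 1), s / 3 ^ (k + 2)))"

definition cut :: "real \<Rightarrow> real \<Rightarrow> real set" where
  "cut a s = affine_onto {a .. a + s} ` gaps"

lemma affine_image_interval:
  assumes "0 < s"
  shows "(\<lambda>y. a + s * y) ` {p <..< q} = {a + s * p <..< a + s * (q :: real)}"
proof (intro equalityI subsetI)
  fix x assume "x \<in> {a + s * p <..< a + s * q}"
  then have "x = a + s * ((x - a) / s)" "(x - a) / s \<in> {p <..< q}"
    using assms by (auto simp: field_simps)
  then show "x \<in> (\<lambda>y. a + s * y) ` {p <..< q}" by blast
qed (use assms in auto)

text \<open>At index 0 both families yield the central interval; counting it twice removes the
  special case.\<close>

lemma gaps_eq:
  "gaps = (\<Union>k. {1 / 3 ^ (k + 1) <..< 2 / 3 ^ (k + 1)} \<union> {1 - 2 / 3 ^ (k + 1) <..< 1 - 1 / 3 ^ (k + 1)})"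
    (is "_ = (\<Union>k. ?L k \<union> ?R k)")
proof -
  have R: "{(3 ^ (k + 1) - 2) / 3 ^ (k + 1) <..< (3 ^ (k + 1) - 1) / 3 ^ (k + 1) :: real} = ?R k" for k
    by (simp add: diff_divide_distrib)
  have UNIV: "(UNIV :: nat set) = insert 0 {k. 1 \<le> k}" by auto
  have R0: "?R 0 = ?L 0" by simp
  have "gaps = (\<Union>k\<in>{k. 1 \<le> k}. ?L k) \<union> ?L 0 \<union> (\<Union>k\<in>{k. 1 \<le> k}. ?R k)"
    unfolding gaps_def R by simp
  also have "\<dots> = (\<Union>k\<in>insert 0 {k. 1 \<le> k}. ?L k \<union> ?R k)"
    unfolding UN_insert UN_Un_distrib R0 by (simp only: Un_ac Un_absorb Un_left_absorb)
  finally show ?thesis unfolding UNIV .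
qed

lemma mem_cut_iff:
  assumes "0 < s"
  shows "x \<in> cut a s \<longleftrightarrow> (\<exists>k. a + s / 3 ^ (k + 1) < x \<and> x < a + 2 * s / 3 ^ (k + 1)
    \<or> a + s - 2 * s / 3 ^ (k + 1) < x \<and> x < a + s - s / 3 ^ (k + 1))"
proof -
  have "cut a s = (\<lambda>y. a + s * y) ` gaps"
    using assms by (simp add: cut_def affine_onto_def)
  then show ?thesis
    unfolding gaps_eq image_UN image_Un affine_image_interval[OF assms]
    by (simp add: algebra_simps)
qed

lemma triadic_mono: "0 \<le> s \<Longrightarrow> i \<le> j \<Longrightarrow> s / 3 ^ j \<le> s / (3 :: real) ^ i"
  by (intro divide_left_mono power_increasing) auto

lemma cut_subset: "0 < s \<Longrightarrow> cut a s \<subseteq> {a <..< a + s}"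
proof
  fix x assume s: "0 < s" and "x \<in> cut a s"
  then obtain k where k: "a + s / 3 ^ (k + 1) < x \<and> x < a + 2 * s / 3 ^ (k + 1)
    \<or> a + s - 2 * s / 3 ^ (k + 1) < x \<and> x < a + s - s / 3 ^ (k + 1)"
    using mem_cut_iff by blast
  have "s / 3 ^ (k + 1) \<le> s / 3" "0 < s / 3 ^ (k + 1)"
    using s triadic_mono[of s 1 "k + 1"] by auto
  moreover have "2 * s / 3 ^ (k + 1) = 2 * (s / 3 ^ (k + 1))" by simp
  ultimately have "a < x \<and> x < a + s" using k s by linarith
  then show "x \<in> {a <..< a + s}" by simp
qed

text \<open>A kid sits between removed intervals of two consecutive scales of the same family, which
  is what makes it a whole component.\<close>

lemma kid_bounds:
  assumes "0 < s" "(b, t) \<in> kids a s"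
  shows "0 < t" "a < b" "b + t < a + s"
    "\<exists>e>0. {b - e <..< b} \<subseteq> cut a s" "\<exists>e>0. {b + t <..< b + t + e} \<subseteq> cut a s"
    "{b .. b + t} \<inter> cut a s = {}"
proof -
  note mono = triadic_mono[OF less_imp_le[OF assms(1)]]
  consider (L) k where "b = a + 2 * (s / 3 ^ (k + 2))" "t = s / 3 ^ (k + 2)"
    | (R) k where "b = a + s - 3 * (s / 3 ^ (k + 2))" "t = s / 3 ^ (k + 2)"
    using assms(2) by (auto simp: kids_def)
  then have "0 < t \<and> a < b \<and> b + t < a + s \<and> (\<exists>e>0. {b - e <..< b} \<subseteq> cut a s) \<and>
    (\<exists>e>0. {b + t <..< b + t + e} \<subseteq> cut a s) \<and> {b .. b + t} \<inter> cut a s = {}"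
  proof cases
    case L
    have t: "0 < t" "t \<le> s / 9" using assms(1) mono[of 2 "k + 2"] by (auto simp: L)
    have "{b - t <..< b} \<subseteq> cut a s"
      unfolding mem_cut_iff[OF assms(1)] subset_iff using L by (auto intro!: exI[of _ "k + 1"])
    moreover have "{b + t <..< b + t + t} \<subseteq> cut a s"
      unfolding mem_cut_iff[OF assms(1)] subset_iff using L by (auto intro!: exI[of _ k])
    moreover have "x \<notin> cut a s" if x: "b \<le> x" "x \<le> b + t" for x
    proof
      assume "x \<in> cut a s"
      then obtain j where "a + s / 3 ^ (j + 1) < x \<and> x < a + 2 * (s / 3 ^ (j + 1))
          \<or> a + s - 2 * (s / 3 ^ (j + 1)) < x \<and> x < a + s - s / 3 ^ (j + 1)"
        using mem_cut_iff[OF assms(1)] by auto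
      moreover have "s / 3 ^ (j + 1) \<le> s / 3" using mono[of 1 "j + 1"] by simp
      moreover have "s / 3 ^ (k + 1) = 3 * t" by (simp add: L)
      \<comment> \<open>No scale lies strictly between \<open>t\<close> and \<open>3 * t\<close>: a
        removed interval of the left family starts no earlier than \<open>b + t\<close> in the first
        case and ends no later than \<open>b\<close> in the second.\<close>
      moreover have "s / 3 ^ (k + 1) \<le> s / 3 ^ (j + 1) \<or> s / 3 ^ (j + 1) \<le> t"
        using mono[of "j + 1" "k + 1"] mono[of "k + 2" "j + 1"] unfolding L by linarith
      ultimately show False using x t L by linarith
    qed
    ultimately show ?thesis using t assms(1) L by (auto intro!: exI[of _ t])
  next
    case R
    have t: "0 < t" "t \<le> s / 9" using assms(1) mono[of 2 "k + 2"] by (auto simp: R)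
    have "s / 3 ^ (k + 1) = 3 * t" "2 * s / 3 ^ (k + 1) = 6 * t" by (simp_all add: R)
    then have "{b - t <..< b} \<subseteq> cut a s"
      unfolding mem_cut_iff[OF assms(1)] subset_iff using R t by (auto intro!: exI[of _ k])
    moreover have "{b + t <..< b + t + t} \<subseteq> cut a s"
      unfolding mem_cut_iff[OF assms(1)] subset_iff using R by (auto intro!: exI[of _ "k + 1"])
    moreover have "x \<notin> cut a s" if x: "b \<le> x" "x \<le> b + t" for x
    proof
      assume "x \<in> cut a s"
      then obtain j where "a + s / 3 ^ (j + 1) < x \<and> x < a + 2 * (s / 3 ^ (j + 1))
          \<or> a + s - 2 * (s / 3 ^ (j + 1)) < x \<and> x < a + s - s / 3 ^ (j + 1)"
        using mem_cut_iff[OF assms(1)] by auto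
      moreover have "s / 3 ^ (j + 1) \<le> s / 3" using mono[of 1 "j + 1"] by simp
      moreover have "s / 3 ^ (k + 1) = 3 * t" by (simp add: R)
      moreover have "s / 3 ^ (k + 1) \<le> s / 3 ^ (j + 1) \<or> s / 3 ^ (j + 1) \<le> t"
        using mono[of "j + 1" "k + 1"] mono[of "k + 2" "j + 1"] unfolding R by linarith
      ultimately show False using x t R by linarith
    qed
    ultimately show ?thesis using t assms(1) R by (auto intro!: exI[of _ t])
  qed
  then show "0 < t" "a < b" "b + t < a + s"
    "\<exists>e>0. {b - e <..< b} \<subseteq> cut a s" "\<exists>e>0. {b + t <..< b + t + e} \<subseteq> cut a s"
    "{b .. b + t} \<inter> cut a s = {}" by auto
qed

lemma triadic_scale:
  assumes "0 < y" "y \<le> s / (3 :: real)"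
  obtains k where "s / 3 ^ (k + 2) < y" "y \<le> s / 3 ^ (k + 1)"
proof -
  have s: "0 < s" using assms by simp
  have "\<exists>k. s / 3 ^ (k + 2) < y"
  proof -
    obtain n where "s / y < 3 ^ n" using real_arch_pow[of 3 "s / y"] by auto
    then have "s / 3 ^ n < y" using assms by (simp add: field_simps)
    moreover have "s / 3 ^ (n + 2) \<le> s / 3 ^ n"
      using s by (intro triadic_mono) auto
    ultimately show ?thesis by (meson le_less_trans)
  qed
  then have "\<exists>k. s / 3 ^ (k + 2) < y \<and> (\<forall>j<k. \<not> s / 3 ^ (j + 2) < y)"
    by (meson exists_least_iff)
  then obtain k where k: "s / 3 ^ (k + 2) < y" "\<forall>j<k. \<not> s / 3 ^ (j + 2) < y" by blast
  have "y \<le> s / 3 ^ (k + 1)"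
  proof (cases k)
    case (Suc j)
    then have "\<not> s / 3 ^ (j + 2) < y" using k(2) by blast
    then show ?thesis using Suc by simp
  qed (use assms in simp)
  then show ?thesis using k(1) that by blast
qed

text \<open>Strictness matters: the ends \<open>a\<close> and \<open>a + s\<close> are never cut,
  yet lie in no kid. They are limits of removed intervals and remain as one-point components, which
  \<open>solid_components\<close> discards.\<close>

lemma kid_exists:
  assumes "0 < s" "a < x" "x < a + s" "x \<notin> cut a s"
  obtains b t where "(b, t) \<in> kids a s" "b \<le> x" "x \<le> b + t"
proof -
  have not_gap: "\<not> (a + s / 3 ^ (k + 1) < x \<and> x < a + 2 * s / 3 ^ (k + 1))"
      "\<not> (a + s - 2 * s / 3 ^ (k + 1) < x \<and> x < a + s - s / 3 ^ (k + 1))" for k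
    using assms mem_cut_iff by blast+
  consider "x - a \<le> s / 3" | "a + s - x \<le> s / 3" using not_gap(1)[of 0] by fastforce
  then show ?thesis
  proof cases
    case 1
    then obtain k where k: "s / 3 ^ (k + 2) < x - a" "x - a \<le> s / 3 ^ (k + 1)"
      using triadic_scale[of "x - a" s] assms by auto
    have "a + 2 * s / 3 ^ (k + 2) \<le> x" "x \<le> a + 2 * s / 3 ^ (k + 2) + s / 3 ^ (k + 2)"
      using k not_gap(1)[of "k + 1"] by auto
    then show ?thesis by (intro that[of "a + 2 * s / 3 ^ (k + 2)"]) (auto simp: kids_def)
  next
    case 2
    then obtain k where k: "s / 3 ^ (k + 2) < a + s - x" "a + s - x \<le> s / 3 ^ (k + 1)"
      using triadic_scale[of "a + s - x" s] assms by auto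
    have "a + s - s / 3 ^ (k + 1) \<le> x" "x \<le> a + s - s / 3 ^ (k + 1) + s / 3 ^ (k + 2)"
      using k not_gap(2)[of "k + 1"] by (auto simp: field_simps)
    then show ?thesis by (intro that[of "a + s - s / 3 ^ (k + 1)"]) (auto simp: kids_def)
  qed
qed

section \<open>Solid components of the subdivision\<close>

primrec pieces :: "nat \<Rightarrow> (real \<times> real) set" where
  "pieces 0 = {(2 / 3, 1 / 3)}"
| "pieces (Suc n) = (\<Union>(a, s)\<in>pieces n. kids a s)"

lemma pieces_pos: "(a, s) \<in> pieces n \<Longrightarrow> 0 < s"
  by (induction n arbitrary: a s) (auto dest: kid_bounds(1))

lemma interval_component:
  fixes S :: "real set"
  assumes "b \<le> c" "{b .. c} \<subseteq> S"
    and "\<exists>e>0. {b - e <..< b} \<inter> S = {}" "\<exists>e>0. {c <..< c + e} \<inter> S = {}"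
  shows "{b .. c} \<in> components S"
proof -
  have "d = {b .. c}" if d: "{b .. c} \<subseteq> d" "d \<subseteq> S" "connected d" for d
  proof -
    have iv: "u \<in> d" if "p \<in> d" "q \<in> d" "p \<le> u" "u \<le> q" for p q u
      using connected_contains_Icc[OF d(3) that(1,2)] that by auto
    have "b \<in> d" "c \<in> d" using assms d by auto
    have "b \<le> p" if "p \<in> d" for p
    proof (rule ccontr)
      assume "\<not> b \<le> p"
      moreover obtain e where e: "0 < e" "{b - e <..< b} \<inter> S = {}" using assms by blast
      ultimately have "max p (b - e / 2) \<in> {b - e <..< b}" by auto
      moreover have "max p (b - e / 2) \<in> d"
        using iv[OF \<open>p \<in> d\<close> \<open>b \<in> d\<close>] \<open>\<not> b \<le> p\<close> e(1) by simp
      ultimately show False using e d by blast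
    qed
    moreover have "p \<le> c" if "p \<in> d" for p
    proof (rule ccontr)
      assume "\<not> p \<le> c"
      moreover obtain e where e: "0 < e" "{c <..< c + e} \<inter> S = {}" using assms by blast
      ultimately have "min p (c + e / 2) \<in> {c <..< c + e}" by auto
      moreover have "min p (c + e / 2) \<in> d"
        using iv[OF \<open>c \<in> d\<close> \<open>p \<in> d\<close>] \<open>\<not> p \<le> c\<close> e(1) by simp
      ultimately show False using e d by blast
    qed
    ultimately show ?thesis using d(1) by auto
  qed
  then show ?thesis using assms(1,2) by (auto simp: in_components_maximal)
qed

text \<open>The induction hypothesis identifies the pieces as components, hence as disjoint, so that
  cuts in one piece leave the kids of another intact. Conversely, a solid component has a point in
  the open interior of a piece; this point survives the cut, so it lies in a kid.\<close>

lemma solid_components_fast_subdivision: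
  "solid_components (fast_subdivision n) = (\<lambda>(a, s). {a .. a + s}) ` pieces n"
proof (induction n)
  case 0
  have "components {2 / 3 .. 1 :: real} = {{2 / 3 .. 1}}"
    by (subst components_eq_sing_iff) auto
  then show ?case by (auto simp: solid_components_def)
next
  case (Suc n)
  let ?D = "fast_subdivision n"
  have D: "fast_subdivision (Suc n) = ?D - (\<Union>(a, s)\<in>pieces n. cut a s)" (is "?D' = _")
    by (simp add: Suc.IH cut_def case_prod_unfold)
  have old: "{a .. a + s} \<in> components ?D" if "(a, s) \<in> pieces n" for a s
    using that Suc.IH by (auto simp: solid_components_def)
  have new: "{b .. b + t} \<in> components ?D'" if as: "(a, s) \<in> pieces n" and bt: "(b, t) \<in> kids a s" for a s b t
  proof -
    note pos = pieces_pos[OF as]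
    note kid = kid_bounds[OF pos bt]
    have sub: "{b .. b + t} \<subseteq> {a .. a + s}" using kid by auto
    have "{b .. b + t} \<inter> cut c u = {}" if cu: "(c, u) \<in> pieces n" for c u
    proof (cases "{c .. c + u} = {a .. a + s}")
      case True
      then have "c = a \<and> u = s" using pos pieces_pos[OF cu] by (auto simp: Icc_eq_Icc)
      then show ?thesis using kid by blast
    next
      case False
      then have "{c .. c + u} \<inter> {a .. a + s} = {}"
        using components_nonoverlap[OF old[OF cu] old[OF as]] by simp
      moreover have "cut c u \<subseteq> {c .. c + u}"
        using cut_subset[OF pieces_pos[OF cu], of c] by (force simp: subset_iff)
      ultimately show ?thesis using sub by blast
    qed
    moreover have "{b .. b + t} \<subseteq> ?D" using sub in_components_subset[OF old[OF as]] by blast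
    ultimately have "{b .. b + t} \<subseteq> ?D'" unfolding D by fast
    moreover have "cut a s \<inter> ?D' = {}" unfolding D using as by blast
    ultimately show ?thesis
      using kid(1,4,5) by (intro interval_component) (auto, (meson disjoint_iff subset_iff)+)
  qed
  show ?case
  proof (intro equalityI subsetI)
    fix C assume "C \<in> solid_components ?D'"
    then have C: "C \<in> components ?D'" "interior C \<noteq> {}" by (auto simp: solid_components_def)
    then have con: "connected C" "C \<subseteq> ?D'" "C \<noteq> {}"
      using in_components_connected in_components_subset in_components_nonempty by blast+
    then obtain J where J: "J \<in> components ?D" "C \<subseteq> J"
      using exists_component_superset[of C ?D] unfolding D by blast
    moreover have "interior J \<noteq> {}" using interior_mono[OF J(2)] C(2) by blast
    ultimately have "J \<in> solid_components ?D" by (simp add: solid_components_def)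
    then obtain a s where as: "(a, s) \<in> pieces n" "J = {a .. a + s}" using Suc.IH by auto
    have "interior C \<subseteq> {a <..< a + s}" using interior_mono[OF J(2)] as(2) by simp
    then obtain x where x: "x \<in> C" "a < x" "x < a + s"
      using C(2) interior_subset by (metis all_not_in_conv greaterThanLessThan_iff subset_iff)
    moreover have "x \<notin> cut a s" using x(1) con(2) as(1) unfolding D by blast
    ultimately obtain b t where bt: "(b, t) \<in> kids a s" "b \<le> x" "x \<le> b + t"
      using kid_exists[OF pieces_pos[OF as(1)]] by metis
    then have "C = {b .. b + t}"
      using components_nonoverlap[OF C(1) new[OF as(1) bt(1)]] x(1) by auto
    then show "C \<in> (\<lambda>(a, s). {a .. a + s}) ` pieces (Suc n)" using as bt by force
  next
    fix C assume "C \<in> (\<lambda>(a, s). {a .. a + s}) ` pieces (Suc n)"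
    then obtain a s b t where *: "(a, s) \<in> pieces n" "(b, t) \<in> kids a s" "C = {b .. b + t}" by auto
    then have "interior C \<noteq> {}" using kid_bounds(1)[OF pieces_pos[OF *(1)] *(2)] by simp
    then show "C \<in> solid_components ?D'" using new[OF *(1,2)] *(3) by (simp add: solid_components_def)
  qed
qed

section \<open>Holes as the union of the cuts of successive steps\<close>

lemma hole_Zeros_iff:
  "hole (Suc n, Zeros) a s x \<longleftrightarrow> (\<exists>k. a + s / 3 ^ (k + 1) < x \<and> x < a + 2 * s / 3 ^ (k + 1)
    \<or> hole (n, Fresh) (a + 2 * s / 3 ^ (k + 1)) (s / 3 ^ (k + 1)) x)"
proof
  have "\<sigma> = (Suc n, Zeros) \<Longrightarrow> \<exists>k. a + s / 3 ^ (k + 1) < x \<and> x < a + 2 * s / 3 ^ (k + 1)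
    \<or> hole (n, Fresh) (a + 2 * s / 3 ^ (k + 1)) (s / 3 ^ (k + 1)) x" if "hole \<sigma> a s x" for \<sigma>
    using that unfolding hole_def
  proof (induction rule: occurs.induct)
    case (here \<sigma> a s)
    then show ?case by (intro exI[of _ 0]) simp
  next
    case (left \<sigma> a s)
    then obtain k where "a + s / 3 / 3 ^ (k + 1) < x \<and> x < a + 2 * (s / 3) / 3 ^ (k + 1)
      \<or> occurs (\<lambda>_ a s. a + s / 3 < x \<and> x < a + 2 * s / 3) (n, Fresh)
          (a + 2 * (s / 3) / 3 ^ (k + 1)) (s / 3 / 3 ^ (k + 1))" by auto
    then show ?case by (intro exI[of _ "k + 1"]) simp
  next
    case (right \<sigma> a s)
    then show ?case by (intro exI[of _ 0]) simp
  qed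
  then show "\<exists>k. a + s / 3 ^ (k + 1) < x \<and> x < a + 2 * s / 3 ^ (k + 1)
    \<or> hole (n, Fresh) (a + 2 * s / 3 ^ (k + 1)) (s / 3 ^ (k + 1)) x"
    if "hole (Suc n, Zeros) a s x" using that by blast
next
  assume "\<exists>k. a + s / 3 ^ (k + 1) < x \<and> x < a + 2 * s / 3 ^ (k + 1)
    \<or> hole (n, Fresh) (a + 2 * s / 3 ^ (k + 1)) (s / 3 ^ (k + 1)) x"
  then obtain k where "a + s / 3 ^ (k + 1) < x \<and> x < a + 2 * s / 3 ^ (k + 1)
    \<or> hole (n, Fresh) (a + 2 * s / 3 ^ (k + 1)) (s / 3 ^ (k + 1)) x" by blast
  then show "hole (Suc n, Zeros) a s x"
  proof (induction k arbitrary: s)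
    case 0
    then show ?case by (subst hole_iff) auto
  next
    case (Suc k)
    then have "hole (Suc n, Zeros) a (s / 3) x" using Suc.IH[of "s / 3"] by simp
    then show ?case by (subst hole_iff) auto
  qed
qed

lemma hole_Twos_iff:
  "hole (Suc n, Twos) a s x \<longleftrightarrow> (\<exists>k. a + s - 2 * s / 3 ^ (k + 1) < x \<and> x < a + s - s / 3 ^ (k + 1)
    \<or> hole (n, Fresh) (a + s - s / 3 ^ k) (s / 3 ^ (k + 1)) x)"
proof
  have "\<sigma> = (Suc n, Twos) \<Longrightarrow> \<exists>k. a + s - 2 * s / 3 ^ (k + 1) < x \<and> x < a + s - s / 3 ^ (k + 1)
    \<or> hole (n, Fresh) (a + s - s / 3 ^ k) (s / 3 ^ (k + 1)) x" if "hole \<sigma> a s x" for \<sigma>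
    using that unfolding hole_def
  proof (induction rule: occurs.induct)
    case (here \<sigma> a s)
    then show ?case by (intro exI[of _ 0]) simp
  next
    case (left \<sigma> a s)
    then show ?case by (intro exI[of _ 0]) simp
  next
    case (right \<sigma> a s)
    have e: "a + 2 * s / 3 + s / 3 = a + s" by simp
    from right obtain k where "a + s - 2 * (s / 3) / 3 ^ (k + 1) < x \<and> x < a + s - s / 3 / 3 ^ (k + 1)
      \<or> occurs (\<lambda>_ a s. a + s / 3 < x \<and> x < a + 2 * s / 3) (n, Fresh)
          (a + s - s / 3 / 3 ^ k) (s / 3 / 3 ^ (k + 1))" unfolding e by auto
    then show ?case by (intro exI[of _ "k + 1"]) simp
  qed
  then show "\<exists>k. a + s - 2 * s / 3 ^ (k + 1) < x \<and> x < a + s - s / 3 ^ (k + 1)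
    \<or> hole (n, Fresh) (a + s - s / 3 ^ k) (s / 3 ^ (k + 1)) x"
    if "hole (Suc n, Twos) a s x" using that by blast
next
  assume "\<exists>k. a + s - 2 * s / 3 ^ (k + 1) < x \<and> x < a + s - s / 3 ^ (k + 1)
    \<or> hole (n, Fresh) (a + s - s / 3 ^ k) (s / 3 ^ (k + 1)) x"
  then obtain k where "a + s - 2 * s / 3 ^ (k + 1) < x \<and> x < a + s - s / 3 ^ (k + 1)
    \<or> hole (n, Fresh) (a + s - s / 3 ^ k) (s / 3 ^ (k + 1)) x" by blast
  then show "hole (Suc n, Twos) a s x"
  proof (induction k arbitrary: a s)
    case 0
    then show ?case by (subst hole_iff) (auto simp: field_simps)
  next
    case (Suc k)
    have "a + 2 * s / 3 + s / 3 = a + s" by simp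
    then have "hole (Suc n, Twos) (a + 2 * s / 3) (s / 3) x"
      using Suc.IH[of "a + 2 * s / 3" "s / 3"] Suc.prems by (simp add: add.commute)
    then show ?case by (subst hole_iff) auto
  qed
qed

text \<open>The link between states and subdivision: the two runs below a fresh node carry out
  exactly one cut, and the nodes interrupting them are the kids, where the counter has dropped by
  one.\<close>

lemma hole_Fresh_iff:
  assumes "0 < s"
  shows "hole (Suc n, Fresh) a s x \<longleftrightarrow>
    x \<in> cut a s \<or> (\<exists>(b, t)\<in>kids a s. hole (n, Fresh) b t x)"
proof -
  have e: "a + 2 * s / 3 + s / 3 = a + s" by simp
  have "x \<in> cut a s \<longleftrightarrow> a + s / 3 < x \<and> x < a + 2 * s / 3
    \<or> (\<exists>k. a + s / 3 / 3 ^ (k + 1) < x \<and> x < a + 2 * (s / 3) / 3 ^ (k + 1))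
    \<or> (\<exists>k. a + s - 2 * (s / 3) / 3 ^ (k + 1) < x \<and> x < a + s - s / 3 / 3 ^ (k + 1))"
    (is "_ \<longleftrightarrow> ?rhs")
  proof -
    have split: "(\<exists>k. P k) \<longleftrightarrow> P 0 \<or> (\<exists>k. P (Suc k))" for P :: "nat \<Rightarrow> bool"
      by (metis nat.exhaust)
    show ?thesis unfolding mem_cut_iff[OF assms] by (subst split) auto
  qed
  moreover have "hole (Suc n, Fresh) a s x \<longleftrightarrow> a + s / 3 < x \<and> x < a + 2 * s / 3
    \<or> (\<exists>k. a + s / 3 / 3 ^ (k + 1) < x \<and> x < a + 2 * (s / 3) / 3 ^ (k + 1)
      \<or> hole (n, Fresh) (a + 2 * (s / 3) / 3 ^ (k + 1)) (s / 3 / 3 ^ (k + 1)) x)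
    \<or> (\<exists>k. a + s - 2 * (s / 3) / 3 ^ (k + 1) < x \<and> x < a + s - s / 3 / 3 ^ (k + 1)
      \<or> hole (n, Fresh) (a + s - s / 3 / 3 ^ k) (s / 3 / 3 ^ (k + 1)) x)"
    by (subst hole_iff) (simp only: hole_Zeros_iff hole_Twos_iff e lchild.simps rchild.simps fst_conv zero_less_Suc simp_thms)
  moreover have "(\<exists>(b, t)\<in>kids a s. hole (n, Fresh) b t x) \<longleftrightarrow>
    (\<exists>k. hole (n, Fresh) (a + 2 * (s / 3) / 3 ^ (k + 1)) (s / 3 / 3 ^ (k + 1)) x)
    \<or> (\<exists>k. hole (n, Fresh) (a + s - s / 3 / 3 ^ k) (s / 3 / 3 ^ (k + 1)) x)"
    by (simp add: kids_def bex_Un)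
  ultimately show ?thesis by metis
qed

lemma not_hole_dead: "\<not> hole (0, q) a s x"
  using occurs_alive[of _ "(0, q)"] by (auto simp: hole_def)

lemma fast_subdivision_eq:
  "fast_subdivision n = {x. 2 / 3 \<le> x \<and> x \<le> 1 \<and>
     (\<forall>i<n. \<forall>(a, s)\<in>pieces i. x \<notin> cut a s)}"
proof (induction n)
  case (Suc n)
  have "fast_subdivision (Suc n) = fast_subdivision n - (\<Union>(a, s)\<in>pieces n. cut a s)"
    by (simp add: solid_components_fast_subdivision cut_def case_prod_unfold)
  then show ?case unfolding Suc.IH by (auto simp: less_Suc_eq)
qed auto

lemma fast_subdivision_3_eq:
  "fast_subdivision 3 = {x. 2 / 3 \<le> x \<and> x \<le> 1 \<and> \<not> hole (3, Fresh) (2 / 3) (1 / 3) x}"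
proof -
  have lt: "(\<forall>i<3. P i) \<longleftrightarrow> P 0 \<and> P 1 \<and> P (2 :: nat)" for P
    by (auto simp: numeral_3_eq_3 less_Suc_eq numeral_2_eq_2)
  have 1: "hole (3, Fresh) (2 / 3) (1 / 3) x \<longleftrightarrow> x \<in> cut (2 / 3) (1 / 3) \<or>
    (\<exists>(b, t)\<in>kids (2 / 3) (1 / 3). hole (2, Fresh) b t x)" for x
    using hole_Fresh_iff[of "1 / 3" 2 "2 / 3" x] by (simp add: eval_nat_numeral)
  have 2: "hole (2, Fresh) a s x \<longleftrightarrow> x \<in> cut a s \<or> (\<exists>(b, t)\<in>kids a s. x \<in> cut b t)"
    if "0 < s" for a s x
  proof -
    have "hole (1, Fresh) b t x \<longleftrightarrow> x \<in> cut b t" if "(b, t) \<in> kids a s" for b t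
      using hole_Fresh_iff[of t 0 b x] kid_bounds(1)[OF \<open>0 < s\<close> that]
      by (simp add: not_hole_dead)
    then have "(\<exists>(b, t)\<in>kids a s. hole (1, Fresh) b t x) \<longleftrightarrow> (\<exists>(b, t)\<in>kids a s. x \<in> cut b t)"
      by (intro bex_cong) auto
    then show ?thesis using hole_Fresh_iff[OF that, of 1 a x] by (simp add: numeral_2_eq_2)
  qed
  have "hole (3, Fresh) (2 / 3) (1 / 3) x \<longleftrightarrow> (\<exists>i<3. \<exists>(a, s)\<in>pieces i. x \<in> cut a s)" for x
  proof -
    have "(\<exists>(b, t)\<in>kids (2 / 3) (1 / 3). hole (2, Fresh) b t x) \<longleftrightarrow>
      (\<exists>(b, t)\<in>kids (2 / 3) (1 / 3). x \<in> cut b t \<or> (\<exists>(c, u)\<in>kids b t. x \<in> cut c u))"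
    proof (intro bex_cong refl)
      fix p assume "p \<in> kids (2 / 3) (1 / 3)"
      then obtain b t where "p = (b, t)" "0 < t"
        by (cases p) (auto dest: kid_bounds(1)[rotated])
      then show "(case p of (b, t) \<Rightarrow> hole (2, Fresh) b t x) \<longleftrightarrow>
          (case p of (b, t) \<Rightarrow> x \<in> cut b t \<or> (\<exists>(c, u)\<in>kids b t. x \<in> cut c u))"
        using 2[of t b x] by simp
    qed
    also have "\<dots> \<longleftrightarrow> (\<exists>(a, s)\<in>pieces 1. x \<in> cut a s) \<or> (\<exists>(a, s)\<in>pieces 2. x \<in> cut a s)"
      by (simp add: numeral_2_eq_2) blast
    finally have "(\<exists>(b, t)\<in>kids (2 / 3) (1 / 3). hole (2, Fresh) b t x) \<longleftrightarrow>
      (\<exists>(a, s)\<in>pieces 1. x \<in> cut a s) \<or> (\<exists>(a, s)\<in>pieces 2. x \<in> cut a s)" .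
    moreover have "(\<exists>i<3. P i) \<longleftrightarrow> P 0 \<or> P 1 \<or> P (2 :: nat)" for P using lt[of "\<lambda>i. \<not> P i"] by blast
    ultimately show ?thesis unfolding 1 by simp
  qed
  then show ?thesis unfolding fast_subdivision_eq by auto
qed

section \<open>Products inside the gaps\<close>

primrec left_end :: "bool list \<Rightarrow> real \<Rightarrow> real \<Rightarrow> real" where
  "left_end [] a s = a"
| "left_end (d # w) a s = left_end w (if d then a + 2 * s / 3 else a) (s / 3)"

primrec state_at :: "bool list \<Rightarrow> state \<Rightarrow> state" where
  "state_at [] \<sigma> = \<sigma>"
| "state_at (d # w) \<sigma> = state_at w (if d then rchild \<sigma> else lchild \<sigma>)"

lemma occurs_path:
  "occurs Q (state_at w \<sigma>) (left_end w a s) (s / 3 ^ length w) \<Longrightarrow> occurs Q \<sigma> a s"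
proof (induction w arbitrary: \<sigma> a s)
  case (Cons d w)
  show ?case
    using Cons.prems Cons.IH[of "lchild \<sigma>" a "s / 3"] Cons.IH[of "rchild \<sigma>" "a + 2 * s / 3" "s / 3"]
    by (cases d) (auto dest: occurs.left occurs.right)
qed simp

lemma left_end_bounds: "0 < s \<Longrightarrow> a \<le> left_end w a s \<and> left_end w a s < a + s"
proof (induction w arbitrary: a s)
  case (Cons d w)
  show ?case
    using Cons.prems Cons.IH[of "s / 3" a] Cons.IH[of "s / 3" "a + 2 * s / 3"] by (cases d) auto
qed simp

text \<open>Valid for every state, since left ends avoid all open middle thirds of the tree. They
  are the explicit factors used to approximate products.\<close>

lemma not_hole_left_end: "0 < s \<Longrightarrow> \<not> hole \<sigma> a s (left_end w a s)"
proof (induction w arbitrary: \<sigma> a s)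
  case Nil
  then show ?case using hole_bounds[of \<sigma> a s a] by auto
next
  case (Cons d w)
  show ?case
  proof
    assume "hole \<sigma> a s (left_end (d # w) a s)"
    then consider "a + s / 3 < left_end (d # w) a s" "left_end (d # w) a s < a + 2 * s / 3"
      | "hole (lchild \<sigma>) a (s / 3) (left_end (d # w) a s)"
      | "hole (rchild \<sigma>) (a + 2 * s / 3) (s / 3) (left_end (d # w) a s)"
      using hole_iff by blast
    then show False
    proof cases
      case 1
      then show False using left_end_bounds[of "s / 3" a w] left_end_bounds[of "s / 3" "a + 2 * s / 3" w] Cons.prems
        by (cases d) auto
    next
      case 2
      then show False
        using hole_bounds[OF 2] left_end_bounds[of "s / 3" "a + 2 * s / 3" w] Cons.IH[of "s / 3"] Cons.prems
        by (cases d) auto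
    next
      case 3
      then show False
        using hole_bounds[OF 3] left_end_bounds[of "s / 3" a w] Cons.IH[of "s / 3"] Cons.prems
        by (cases d) auto
    qed
  qed
qed

text \<open>
  The hypotheses persist for the four pairs of outer thirds, whose product intervals cover the
  whole interval; only for squares of intervals does the covering fail.
\<close>
lemma product_approx:
  assumes "0 < a" "0 < t" "a + t \<le> b" "b + t \<le> 3 * a" "b + t \<le> 1"
    "a * b \<le> z" "z \<le> (a + t) * (b + t)"
  shows "\<exists>u v. \<bar>z - left_end u a t * left_end v b t\<bar> \<le> 3 * t / 3 ^ m"
  using assms
proof (induction m arbitrary: a b t)
  case 0
  have "t * (a + b + t) \<le> t * 3" using 0 by (intro mult_left_mono) auto
  then have "\<bar>z - left_end [] a t * left_end [] b t\<bar> \<le> 3 * t / 3 ^ 0" using 0 by (simp add: algebra_simps)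
  then show ?case by blast
next
  case (Suc m)
  define r where "r = t / 3"
  have t: "t = 3 * r" by (simp add: r_def)
  have r: "0 < r" "a + 3 * r \<le> b" "b + 3 * r \<le> 3 * a" "b + 3 * r \<le> 1" using Suc.prems t by auto
  have e: "c + 2 * r + r = c + 3 * r" for c by simp
  have f: "0 \<le> r * (b - a - 3 * r)" "0 \<le> r * (3 * a - b - 3 * r)" "0 \<le> r * r" "0 \<le> r * a"
    using r Suc.prems by auto
  \<comment> \<open>The four product intervals overlap in this order. The seams LL-LR and RL-RR rest
    on \<open>a + t \<le> b\<close>, the seam LR-RL on \<open>b + t \<le> 3 * a\<close>.\<close>
  consider (LL) "z \<le> (a + r) * (b + r)"
    | (LR) "a * (b + 2 * r) \<le> z" "z \<le> (a + r) * (b + 3 * r)"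
    | (RL) "(a + 2 * r) * b \<le> z" "z \<le> (a + 3 * r) * (b + r)"
    | (RR) "(a + 2 * r) * (b + 2 * r) \<le> z"
    using f by (simp add: algebra_simps del: zero_le_square) linarith
  then show ?case
  proof cases
    case LL
    then obtain u v where "\<bar>z - left_end u a r * left_end v b r\<bar> \<le> 3 * r / 3 ^ m"
      using Suc.IH[of a r b] Suc.prems r by auto
    then show ?thesis by (intro exI[of _ "False # u"] exI[of _ "False # v"]) (simp add: t)
  next
    case LR
    then obtain u v where "\<bar>z - left_end u a r * left_end v (b + 2 * r) r\<bar> \<le> 3 * r / 3 ^ m"
      using Suc.IH[of a r "b + 2 * r", unfolded e] Suc.prems r by auto
    then show ?thesis by (intro exI[of _ "False # u"] exI[of _ "True # v"]) (simp add: t)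
  next
    case RL
    then obtain u v where "\<bar>z - left_end u (a + 2 * r) r * left_end v b r\<bar> \<le> 3 * r / 3 ^ m"
      using Suc.IH[of "a + 2 * r" r b, unfolded e] Suc.prems r by auto
    then show ?thesis by (intro exI[of _ "True # u"] exI[of _ "False # v"]) (simp add: t)
  next
    case RR
    then obtain u v where "\<bar>z - left_end u (a + 2 * r) r * left_end v (b + 2 * r) r\<bar> \<le> 3 * r / 3 ^ m"
      using Suc.IH[of "a + 2 * r" r "b + 2 * r", unfolded e] Suc.prems r t by auto
    then show ?thesis by (intro exI[of _ "True # u"] exI[of _ "True # v"]) (simp add: t)
  qed
qed

text \<open>The range from the least to the greatest product of a point of the left third with a
  point of the right third.\<close>

definition filled :: "real \<Rightarrow> state \<Rightarrow> real \<Rightarrow> real \<Rightarrow> bool" where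
  "filled z \<sigma> a s \<longleftrightarrow> a * (a + 2 * s / 3) \<le> z \<and> z \<le> (a + s / 3) * (a + s)"

lemma filled_approx:
  assumes "occurs (filled z) \<sigma> a s" "2 / 3 \<le> a" "0 < s" "a + s \<le> 1"
  shows "\<exists>u v. \<bar>z - left_end u a s * left_end v a s\<bar> \<le> 1 / 3 ^ m"
  using assms
proof (induction rule: occurs.induct)
  case (here \<sigma> a s)
  have e: "a + 2 * s / 3 + s / 3 = a + s" by simp
  obtain u v where "\<bar>z - left_end u a (s / 3) * left_end v (a + 2 * s / 3) (s / 3)\<bar> \<le> 3 * (s / 3) / 3 ^ m"
    using product_approx[of a "s / 3" "a + 2 * s / 3" z m] here e by (auto simp: filled_def)
  moreover have "3 * (s / 3) / 3 ^ m \<le> 1 / 3 ^ m" using here by (intro divide_right_mono) auto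
  ultimately show ?case by (intro exI[of _ "False # u"] exI[of _ "True # v"]) simp
next
  case (left \<sigma> a s)
  then obtain u v where "\<bar>z - left_end u a (s / 3) * left_end v a (s / 3)\<bar> \<le> 1 / 3 ^ m" by auto
  then show ?case by (intro exI[of _ "False # u"] exI[of _ "False # v"]) simp
next
  case (right \<sigma> a s)
  then obtain u v where "\<bar>z - left_end u (a + 2 * s / 3) (s / 3) * left_end v (a + 2 * s / 3) (s / 3)\<bar> \<le> 1 / 3 ^ m"
    by auto
  then show ?case by (intro exI[of _ "True # u"] exI[of _ "True # v"]) simp
qed

text \<open>Filled interval and gap of one node meet at \<open>(a + s / 3) * (a + s)\<close>, and
  the filled one starts \<open>s^2 / 9\<close> below \<open>(a + s / 3)^2\<close>; together they
  cover the squares of the middle third.\<close>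

lemma square_of_hole:
  assumes "hole \<sigma> a s x" "0 \<le> a" "0 < s"
  shows "gap \<sigma> a s (x\<^sup>2) \<or> occurs (filled (x\<^sup>2)) \<sigma> a s"
  using assms unfolding hole_def gap_def
proof (induction rule: occurs.induct)
  case (here \<sigma> a s)
  have "x\<^sup>2 < (a + 2 * s / 3)\<^sup>2" using here by (intro power_strict_mono) auto
  moreover have "a * (a + 2 * s / 3) \<le> x\<^sup>2"
  proof -
    have "a * (a + 2 * s / 3) \<le> (a + s / 3)\<^sup>2" by (simp add: power2_eq_square algebra_simps)
    also have "\<dots> \<le> x\<^sup>2" using here by (intro power_mono) auto
    finally show ?thesis .
  qed
  ultimately show ?case using here(1)
    by (auto simp: filled_def not_less intro!: occurs.here)
qed (auto dest: occurs.left occurs.right)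

text \<open>A gap \<open>z\<close> of the left third that is nevertheless a product of a point of the left third
  and a point of the right third.\<close>
definition late :: "real \<Rightarrow> state \<Rightarrow> real \<Rightarrow> real \<Rightarrow> bool" where
  "late z \<sigma> a s \<longleftrightarrow> gap (lchild \<sigma>) a (s / 3) z \<and> a * (a + 2 * s / 3) \<le> z"

lemma not_holeD:
  assumes "\<not> hole \<sigma> a s x" "0 < fst \<sigma>"
  shows "x \<le> a + s / 3 \<or> a + 2 * s / 3 \<le> x" "\<not> hole (lchild \<sigma>) a (s / 3) x"
    "\<not> hole (rchild \<sigma>) (a + 2 * s / 3) (s / 3) x"
  using assms hole_iff not_le by metis+

text \<open>At the node of the gap itself no surviving pair of factors exists. Ascending from a left
  child, either both factors stay in the left third or the larger one lies in the right third, which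
  makes the gap late. Ascending from a right child, both factors are forced into the right
  third.\<close>

lemma product_in_gap:
  assumes "gap \<sigma> a s (x * y)" "0 < a" "0 < s" "a \<le> x" "x \<le> y" "y \<le> a + s"
    "\<not> hole \<sigma> a s x" "\<not> hole \<sigma> a s y"
  shows "occurs (late (x * y)) \<sigma> a s"
  using assms unfolding gap_def
proof (induction rule: occurs.induct)
  case (here \<sigma> a s)
  have "x \<le> a + s / 3 \<or> a + 2 * s / 3 \<le> x" "y \<le> a + s / 3 \<or> a + 2 * s / 3 \<le> y"
    using here not_holeD(1) by blast+
  moreover have "x * y \<le> (a + s / 3) * (a + s)" if "x \<le> a + s / 3"
    using that here by (intro mult_mono) auto
  moreover have "(a + 2 * s / 3)\<^sup>2 \<le> x * y" if "a + 2 * s / 3 \<le> x"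
    using that here unfolding power2_eq_square by (intro mult_mono) auto
  ultimately show ?case using here by auto
next
  case (left \<sigma> a s)
  have alive: "0 < fst \<sigma>" using occurs_alive[OF left(1)] alive_lchild by blast
  have g: "gap (lchild \<sigma>) a (s / 3) (x * y)" using left(1) by (simp add: gap_def)
  then have "x * y < (a + s / 3)\<^sup>2" using gap_bounds left by simp
  moreover have "(a + s / 3)\<^sup>2 \<le> x * y" if "a + s / 3 \<le> x"
    using that left unfolding power2_eq_square by (intro mult_mono) auto
  ultimately have x: "x < a + s / 3" by argo
  show ?case
  proof (cases "y \<le> a + s / 3")
    case True
    have "\<not> hole (lchild \<sigma>) a (s / 3) x" "\<not> hole (lchild \<sigma>) a (s / 3) y"
      using left alive not_holeD(2) by blast+
    then show ?thesis using left True by (intro occurs.left[OF left.IH]) auto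
  next
    case False
    then have "a + 2 * s / 3 \<le> y" using left(9) alive not_holeD(1) by blast
    then have "a * (a + 2 * s / 3) \<le> x * y" using left by (intro mult_mono) auto
    then show ?thesis using g alive by (intro occurs.here) (auto simp: late_def)
  qed
next
  case (right \<sigma> a s)
  have alive: "0 < fst \<sigma>" using occurs_alive[OF right(1)] alive_rchild by blast
  have "gap (rchild \<sigma>) (a + 2 * s / 3) (s / 3) (x * y)" using right(1) by (simp add: gap_def)
  then have g: "(a + 2 * s / 3)\<^sup>2 < x * y" using gap_bounds[of "rchild \<sigma>" "a + 2 * s / 3" "s / 3" "x * y"] right by simp
  have "a + 2 * s / 3 \<le> x"
  proof (rule ccontr)
    assume "\<not> a + 2 * s / 3 \<le> x"
    then have "x \<le> a + s / 3" using right(8) alive not_holeD(1) by blast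
    then have "x * y \<le> (a + s / 3) * (a + s)" using right by (intro mult_mono) auto
    moreover have "0 \<le> s\<^sup>2 / 9" by simp
    ultimately show False using g gap_length[of a s] by linarith
  qed
  moreover have "\<not> hole (rchild \<sigma>) (a + 2 * s / 3) (s / 3) x" "\<not> hole (rchild \<sigma>) (a + 2 * s / 3) (s / 3) y"
    using right alive not_holeD(3) by blast+
  ultimately show ?case using right by (intro occurs.right[OF right.IH]) auto
qed

lemma late_gap: "occurs (late z) \<sigma> a s \<Longrightarrow> gap \<sigma> a s z"
proof (induction rule: occurs.induct)
  case (here \<sigma> a s)
  then show ?case using gap_iff[of \<sigma> a s z] by (simp add: late_def)
next
  case (left \<sigma> a s)
  from left.IH show ?case unfolding gap_def by (rule occurs.left)
next
  case (right \<sigma> a s)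
  from right.IH show ?case unfolding gap_def by (rule occurs.right)
qed

text \<open>At each level the middle gap and the gaps of the left child lie below
  \<open>(a + 2 * s / 3)^2\<close>. This locates late gaps, which sit near the right end of the left
  third.\<close>

lemma gap_right_end:
  assumes "gap \<sigma> a s z" "(a + s - s / 3 ^ j)\<^sup>2 \<le> z" "0 \<le> a" "0 < s"
  shows "gap ((rchild ^^ j) \<sigma>) (a + s - s / 3 ^ j) (s / 3 ^ j) z"
  using assms
proof (induction j arbitrary: \<sigma> a s)
  case (Suc j)
  have e: "a + 2 * s / 3 + s / 3 = a + s" by simp
  have "s / 3 ^ Suc j \<le> s / 3 ^ 1" using Suc.prems by (intro divide_left_mono power_increasing) auto
  then have "(a + 2 * s / 3)\<^sup>2 \<le> (a + s - s / 3 ^ Suc j)\<^sup>2"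
    using Suc.prems by (intro power_mono) auto
  then have z: "(a + 2 * s / 3)\<^sup>2 \<le> z" using Suc.prems by linarith
  moreover have "(a + s / 3)\<^sup>2 \<le> (a + 2 * s / 3)\<^sup>2" using Suc.prems by (intro power_mono) auto
  ultimately have "\<not> z < (a + s / 3)\<^sup>2" "\<not> z < (a + 2 * s / 3)\<^sup>2" by linarith+
  then have "gap (rchild \<sigma>) (a + 2 * s / 3) (s / 3) z"
    using Suc.prems gap_iff[of \<sigma> a s z] gap_bounds[of "lchild \<sigma>" a "s / 3" z] by auto
  then have "gap ((rchild ^^ j) (rchild \<sigma>)) (a + s - s / 3 / 3 ^ j) (s / 3 / 3 ^ j) z"
    using Suc.IH[of "rchild \<sigma>" "a + 2 * s / 3" "s / 3"] Suc.prems e by (simp add: add.commute)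
  then show ?case by (simp add: funpow_swap1)
qed simp

text \<open>
  The late gaps of \<open>[a, a + s]\<close> itself lie above the square of the last \<open>s\<^sup>2 / 9\<close> of its left
  third.  Since \<open>s\<close> is a power of \<open>1 / 3\<close>, this is again a node, whose gaps have
  measure at most \<open>(s\<^sup>2 / 9)\<^sup>2 / 7\<close>; the constant solves \<open>\<kappa> = 1 / 567 + 2 * \<kappa> / 81\<close>.
\<close>
lemma late_cover:
  assumes "2 / 3 \<le> a" "s = 1 / 3 ^ (n + 1)" "a + s \<le> 1"
  shows "\<exists>B\<in>lmeasurable. {z. occurs (late z) \<sigma> a s} \<subseteq> B
    \<and> measure lebesgue B \<le> s ^ 4 / 553 + 2 * s * (2 / 3) ^ d"
  using assms
proof (induction d arbitrary: \<sigma> a s n)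
  case 0
  have s: "0 < s" using 0 by simp
  have "{z. occurs (late z) \<sigma> a s} \<subseteq> {a\<^sup>2 .. (a + s)\<^sup>2}"
    using gap_subset[OF _ s, of a \<sigma>] 0(1) late_gap by fastforce
  moreover have "measure lebesgue {a\<^sup>2 .. (a + s)\<^sup>2} \<le> s ^ 4 / 553 + 2 * s * (2 / 3) ^ 0"
  proof -
    have "measure lebesgue {a\<^sup>2 .. (a + s)\<^sup>2} = s * (2 * a + s)"
      using 0(1) s by (simp add: power2_eq_square algebra_simps)
    also have "\<dots> \<le> s * 2" using 0(1,3) s by (intro mult_left_mono) auto
    also have "\<dots> \<le> s ^ 4 / 553 + 2 * s * (2 / 3) ^ 0" by simp
    finally show ?thesis .
  qed
  ultimately show ?case by (intro bexI[of _ "{a\<^sup>2 .. (a + s)\<^sup>2}"]) auto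
next
  case (Suc d)
  have s: "0 < s" "s \<le> 1 / 3" using Suc.prems by auto
  have s3: "s / 3 = 1 / 3 ^ (n + 1 + 1)" using Suc.prems(2) by simp
  define q where "q = s\<^sup>2 / 9"
  have q: "q = s / 3 / 3 ^ (n + 2)" using Suc.prems by (simp add: q_def power2_eq_square)
  have "s * s \<le> 1 * 1" using s by (intro mult_mono) auto
  then have q0: "0 < q" "q \<le> 1 / 9" using s by (auto simp: q_def power2_eq_square)
  let ?\<tau> = "(rchild ^^ (n + 2)) (lchild \<sigma>)"
  let ?C = "{z. gap ?\<tau> (a + s / 3 - q) q z}"
  have pos: "0 \<le> a + s / 3 - q" "a + s / 3 - q + q \<le> 1" using q0 Suc.prems(1,3) s by auto
  obtain L where L: "L \<in> lmeasurable" "{z. occurs (late z) (lchild \<sigma>) a (s / 3)} \<subseteq> L"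
    "measure lebesgue L \<le> (s / 3) ^ 4 / 553 + 2 * (s / 3) * (2 / 3) ^ d"
    using Suc.IH[of a "s / 3" "n + 1" "lchild \<sigma>", OF _ s3] Suc.prems(1,3) s by auto
  obtain R where R: "R \<in> lmeasurable" "{z. occurs (late z) (rchild \<sigma>) (a + 2 * s / 3) (s / 3)} \<subseteq> R"
    "measure lebesgue R \<le> (s / 3) ^ 4 / 553 + 2 * (s / 3) * (2 / 3) ^ d"
    using Suc.IH[of "a + 2 * s / 3" "s / 3" "n + 1" "rchild \<sigma>", OF _ s3] Suc.prems(1,3) s by auto
  have "z \<in> ?C" if "late z \<sigma> a s" for z
  proof -
    \<comment> \<open>Here \<open>a \<ge> 2 / 3\<close> enters: moving down from
      \<open>a + s / 3\<close> by \<open>q\<close> lowers the square by at least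
      \<open>q = s^2 / 9\<close>, hence to the threshold of \<open>late\<close> or below.\<close>
    have "0 \<le> q * (2 * (a + s / 3) - 1 - q)" using q0 Suc.prems(1) s by (intro mult_nonneg_nonneg) auto
    then have "(a + s / 3 - q)\<^sup>2 \<le> (a + s / 3)\<^sup>2 - q" by (simp add: power2_eq_square algebra_simps)
    also have "\<dots> = a * (a + 2 * s / 3)" by (simp add: q_def power2_eq_square field_simps)
    finally show ?thesis
      using that gap_right_end[of "lchild \<sigma>" a "s / 3" z "n + 2"] Suc.prems(1) s
      by (simp add: late_def q)
  qed
  then have "{z. occurs (late z) \<sigma> a s} \<subseteq> ?C \<union> L \<union> R"
    using L(2) R(2) occurs_iff[of _ \<sigma> a s] by blast
  moreover have C: "?C \<in> lmeasurable" using lmeasurable_gap pos q0 by blast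
  moreover have "measure lebesgue ?C \<le> s ^ 4 / 567"
  proof -
    have "measure lebesgue ?C \<le> 1 / 7 * q\<^sup>2"
      unfolding measure_gap[OF pos(1) q0(1) pos(2)] using weight_bounds by (intro mult_right_mono) auto
    then show ?thesis by (simp add: q_def power_divide)
  qed
  moreover have "measure lebesgue (?C \<union> L \<union> R) \<le> measure lebesgue ?C + measure lebesgue L + measure lebesgue R"
    using C L(1) R(1) measure_Un_le[of ?C lebesgue L] measure_Un_le[of "?C \<union> L" lebesgue R]
    by (auto simp: fmeasurableD)
  moreover have "s ^ 4 / 567 + 2 * ((s / 3) ^ 4 / 553) = s ^ 4 / 553" by (simp add: power_divide)
  moreover have "2 * s * (2 / 3) ^ Suc d = 2 * (2 * (s / 3) * (2 / 3) ^ d)" by simp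
  ultimately show ?case using L R C
    by (intro bexI[of _ "?C \<union> L \<union> R"]) (auto intro: fmeasurable.Un)
qed

section \<open>The measure of the product set\<close>

definition products :: "real set" where
  "products = (\<lambda>(x, y). x * y) ` (fast_subdivision 3 \<times> fast_subdivision 3)"

definition root_gaps :: "real set" where
  "root_gaps = {z. gap (3, Fresh) (2 / 3) (1 / 3) z}"

lemma productsI:
  assumes "2 / 3 \<le> x" "x \<le> 1" "\<not> hole (3, Fresh) (2 / 3) (1 / 3) x"
    "2 / 3 \<le> y" "y \<le> 1" "\<not> hole (3, Fresh) (2 / 3) (1 / 3) y"
  shows "x * y \<in> products"
  using assms unfolding products_def fast_subdivision_3_eq by (intro image_eqI[of _ _ "(x, y)"]) auto

lemma compact_products: "compact products"
proof -
  have "fast_subdivision 3 = {2 / 3 .. 1} - {x. hole (3, Fresh) (2 / 3) (1 / 3) x}"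
    unfolding fast_subdivision_3_eq by auto
  then have "compact (fast_subdivision 3)" using compact_diff[OF compact_Icc open_hole] by simp
  then show ?thesis unfolding products_def case_prod_unfold
    by (intro compact_continuous_image compact_Times) (auto intro!: continuous_intros)
qed

lemma products_subset: "products \<subseteq> {4 / 9 .. 1}"
proof -
  have "4 / 9 \<le> x * y \<and> x * y \<le> 1" if "2 / 3 \<le> x" "x \<le> 1" "2 / 3 \<le> y" "y \<le> 1" for x y :: real
    using that mult_mono[of "2 / 3" x "2 / 3" y] mult_mono[of x 1 y 1] by auto
  then show ?thesis unfolding products_def fast_subdivision_3_eq by auto
qed

text \<open>Products of left ends come arbitrarily close to \<open>z\<close>; compactness of the
  product set turns this into membership.\<close>

lemma filled_products:
  assumes "occurs (filled z) (3, Fresh) (2 / 3) (1 / 3)"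
  shows "z \<in> products"
proof -
  have "\<exists>p\<in>products. dist p z < e" if e: "0 < e" for e
  proof -
    obtain m where m: "(1 / 3) ^ m < e" using real_arch_pow_inv[OF e, of "1 / 3"] by auto
    obtain u v where "\<bar>z - left_end u (2 / 3) (1 / 3) * left_end v (2 / 3) (1 / 3)\<bar> \<le> 1 / 3 ^ m"
      using filled_approx[OF assms, of m] by auto
    moreover have "left_end u (2 / 3) (1 / 3) * left_end v (2 / 3) (1 / 3) \<in> products"
      using not_hole_left_end[of "1 / 3"] left_end_bounds[of "1 / 3" "2 / 3"] less_imp_le
      by (intro productsI) fastforce+
    ultimately show ?thesis using m
      by (intro bexI[of _ "left_end u (2 / 3) (1 / 3) * left_end v (2 / 3) (1 / 3)"])
        (auto simp: dist_real_def abs_minus_commute power_divide)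
  qed
  then have "z \<in> closure products" by (simp add: closure_approachable)
  then show ?thesis using compact_products by (simp add: compact_imp_closed closure_closed)
qed

text \<open>If \<open>sqrt z\<close> survived, \<open>z\<close> would be its square and thus a
  product. So \<open>sqrt z\<close> is in a hole, and the alternative that \<open>z\<close> is
  filled is excluded as well.\<close>

lemma complement_products: "{4 / 9 .. 1} - products \<subseteq> root_gaps"
proof
  fix z assume "z \<in> {4 / 9 .. 1} - products"
  then have z: "4 / 9 \<le> z" "z \<le> 1" "z \<notin> products" by auto
  have r: "2 / 3 \<le> sqrt z" "sqrt z \<le> 1" "(sqrt z)\<^sup>2 = z"
    using z real_le_rsqrt[of "2 / 3" z] by (simp_all add: power_divide)
  have "hole (3, Fresh) (2 / 3) (1 / 3) (sqrt z)"
    using productsI[OF r(1,2) _ r(1,2)] z r(3) by (auto simp: power2_eq_square)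
  then show "z \<in> root_gaps"
    using square_of_hole[of _ "2 / 3" "1 / 3" "sqrt z"] filled_products z r(3)
    by (auto simp: root_gaps_def)
qed

lemma products_in_gaps:
  assumes "z \<in> products" "z \<in> root_gaps"
  shows "occurs (late z) (3, Fresh) (2 / 3) (1 / 3)"
proof -
  let ?D = "fast_subdivision 3"
  from assms(1) obtain x y where "x \<in> ?D" "y \<in> ?D" "z = x * y" by (auto simp: products_def)
  then obtain x y where xy: "x \<in> ?D" "y \<in> ?D" "z = x * y" "x \<le> y"
    by (metis mult.commute linear)
  then show ?thesis
    using product_in_gap[of _ "2 / 3" "1 / 3" x y] assms(2)
    by (auto simp: fast_subdivision_3_eq root_gaps_def)
qed

text \<open>The gaps of a node without those of its left third. When that third is too low to
  contribute, the late gaps are confined to this set, whose measure is known exactly.\<close>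

definition right_gaps :: "state \<Rightarrow> real \<Rightarrow> real \<Rightarrow> real set" where
  "right_gaps \<sigma> a s = {(a + s / 3) * (a + s) <..< (a + 2 * s / 3)\<^sup>2}
    \<union> {z. gap (rchild \<sigma>) (a + 2 * s / 3) (s / 3) z}"

lemma right_gaps_bounds:
  assumes "z \<in> right_gaps \<sigma> a s" "0 \<le> a" "0 < s"
  shows "(a + s / 3) * (a + s) < z \<and> z < (a + s)\<^sup>2"
proof -
  have e: "a + 2 * s / 3 + s / 3 = a + s" by simp
  have "0 \<le> s\<^sup>2 / 9" by simp
  then have 1: "(a + s / 3) * (a + s) \<le> (a + 2 * s / 3)\<^sup>2" using gap_length[of a s] by linarith
  have 2: "(a + 2 * s / 3)\<^sup>2 \<le> (a + s)\<^sup>2" using assms by (intro power_mono) auto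
  from assms(1) consider "(a + s / 3) * (a + s) < z" "z < (a + 2 * s / 3)\<^sup>2"
    | "gap (rchild \<sigma>) (a + 2 * s / 3) (s / 3) z"
    unfolding right_gaps_def by auto
  then show ?thesis
  proof cases
    case 1
    then show ?thesis using 2 by linarith
  next
    case 2
    then have "(a + 2 * s / 3)\<^sup>2 < z" "z < (a + s)\<^sup>2"
      using gap_bounds[OF 2] assms unfolding e by auto
    then show ?thesis using 1 by linarith
  qed
qed

lemma right_gaps_gap: "0 < fst \<sigma> \<Longrightarrow> z \<in> right_gaps \<sigma> a s \<Longrightarrow> gap \<sigma> a s z"
  using gap_iff[of \<sigma> a s z] by (auto simp: right_gaps_def)

lemma lmeasurable_right_gaps:
  assumes "0 \<le> a" "0 < s"
  shows "right_gaps \<sigma> a s \<in> lmeasurable"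
  using assms lmeasurable_gap[of "a + 2 * s / 3" "s / 3"] unfolding right_gaps_def
  by (intro fmeasurable.Un) auto

lemma measure_right_gaps:
  assumes "0 \<le> a" "0 < s" "a + s \<le> 1"
  shows "measure lebesgue (right_gaps \<sigma> a s) = (1 + weight (rchild \<sigma>)) * s\<^sup>2 / 9"
  using assms measure_gap_Un_right[of a s "rchild \<sigma>"] measure_gap[of "a + 2 * s / 3" "s / 3" "rchild \<sigma>"]
  by (simp add: right_gaps_def power_divide field_simps)

lemma late_right_gaps:
  assumes "late z \<sigma> a s" "0 \<le> a" "0 < s" "c = a + s / 3 - t" "t = s / 3 / 3 ^ j"
    "(c + t / 3)\<^sup>2 \<le> a * (a + 2 * s / 3)"
  shows "z \<in> right_gaps ((rchild ^^ j) (lchild \<sigma>)) c t"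
proof -
  have t: "0 < t" "t \<le> s / 3" using assms triadic_mono[of "s / 3" 0 j] by auto
  have c: "0 \<le> c" using assms t by simp
  have "c\<^sup>2 \<le> (c + t / 3)\<^sup>2" using t c by (intro power_mono) auto
  then have "c\<^sup>2 \<le> z" and "(c + t / 3)\<^sup>2 \<le> z" using assms(1,6) by (auto simp: late_def)
  have g: "gap ((rchild ^^ j) (lchild \<sigma>)) c t z"
    using gap_right_end[of "lchild \<sigma>" a "s / 3" z j] assms \<open>c\<^sup>2 \<le> z\<close> by (simp add: late_def)
  have "\<not> gap \<tau> c (t / 3) z" for \<tau>
    using gap_bounds[of \<tau> c "t / 3" z] \<open>(c + t / 3)\<^sup>2 \<le> z\<close> c t by auto
  then show ?thesis using gap_iff[THEN iffD1, OF g] by (simp add: right_gaps_def)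
qed

lemma gap_path:
  "gap (state_at w \<sigma>) (left_end w a s) (s / 3 ^ length w) z \<Longrightarrow> gap \<sigma> a s z"
  unfolding gap_def by (rule occurs_path)

lemma measure_root_gaps: "measure lebesgue root_gaps = weight (3, Fresh) / 9"
  unfolding root_gaps_def by (subst measure_gap) (auto simp: power_divide)

lemma root_gaps_subset: "root_gaps \<subseteq> {4 / 9 .. 1}"
  using gap_subset[of "2 / 3" "1 / 3"] unfolding root_gaps_def by (auto simp: power_divide)

lemma lmeasurable_root_gaps: "root_gaps \<in> lmeasurable"
  unfolding root_gaps_def by (rule lmeasurable_gap) auto

lemma weights: "weight (3, Fresh) = 6665 / 46656" "weight (2, Twos) = 41 / 288"
  by (simp_all add: eval_nat_numeral)

text \<open>The nodes below have the ternary addresses 022, 00222 and 20222 in \<open>[2 / 3, 1]\<close>; their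
  gaps are filled by products from the two outer thirds of the nodes with the empty address, 0
  and 2, respectively.\<close>
lemma measure_products_lower:
  "91782446 / 170061120 \<le> measure lebesgue products"
proof -
  let ?\<tau> = "(2, Twos)"
  let ?X = "right_gaps ?\<tau> (62 / 81) (1 / 81)"
  let ?Y = "right_gaps ?\<tau> (512 / 729) (1 / 729)"
  let ?Z = "right_gaps ?\<tau> (674 / 729) (1 / 729)"
  have filled: "z \<in> products"
    if "0 < fst (state_at w (3, Fresh))" "filled z (state_at w (3, Fresh)) (left_end w (2 / 3) (1 / 3)) (1 / 3 / 3 ^ length w)" for w z
    by (rule filled_products, rule occurs_path[of _ w]) (use that occurs.here in blast)
  have X: "z \<in> products \<and> z \<in> root_gaps" if "z \<in> ?X" for z
  proof
    show "z \<in> products"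
      using right_gaps_bounds[OF that] filled[of "[]" z]
      by (auto simp: filled_def power2_eq_square)
    show "z \<in> root_gaps"
      using right_gaps_gap[OF _ that] gap_path[of "[False, True, True]" "(3, Fresh)" "2 / 3" "1 / 3" z]
      by (simp add: root_gaps_def eval_nat_numeral)
  qed
  have Y: "z \<in> products \<and> z \<in> root_gaps" if "z \<in> ?Y" for z
  proof
    show "z \<in> products"
      using right_gaps_bounds[OF that] filled[of "[False]" z]
      by (auto simp: filled_def power2_eq_square eval_nat_numeral)
    show "z \<in> root_gaps"
      using right_gaps_gap[OF _ that]
        gap_path[of "[False, False, True, True, True]" "(3, Fresh)" "2 / 3" "1 / 3" z]
      by (simp add: root_gaps_def eval_nat_numeral)
  qed
  have Z: "z \<in> products \<and> z \<in> root_gaps" if "z \<in> ?Z" for z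
  proof
    show "z \<in> products"
      using right_gaps_bounds[OF that] filled[of "[True]" z]
      by (auto simp: filled_def power2_eq_square eval_nat_numeral)
    show "z \<in> root_gaps"
      using right_gaps_gap[OF _ that]
        gap_path[of "[True, False, True, True, True]" "(3, Fresh)" "2 / 3" "1 / 3" z]
      by (simp add: root_gaps_def eval_nat_numeral)
  qed
  have lm: "?X \<in> lmeasurable" "?Y \<in> lmeasurable" "?Z \<in> lmeasurable"
    by (auto intro: lmeasurable_right_gaps)
  have disj: "?X \<inter> ?Y = {}" "(?X \<union> ?Y) \<inter> ?Z = {}"
    using right_gaps_bounds[of _ ?\<tau> "62 / 81" "1 / 81"] right_gaps_bounds[of _ ?\<tau> "512 / 729" "1 / 729"]
      right_gaps_bounds[of _ ?\<tau> "674 / 729" "1 / 729"]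
    by (fastforce simp: power2_eq_square)+
  have "measure lebesgue (?X \<union> ?Y \<union> ?Z) = measure lebesgue ?X + measure lebesgue ?Y + measure lebesgue ?Z"
    using lm disj by (simp add: measure_Un2 Diff_triv Int_commute fmeasurable.Un)
  \<comment> \<open>The factor \<open>329 / 288\<close> is \<open>1 + weight (2, Twos)\<close>: the
    middle gap together with the gaps of the right child, which is again in state
    \<open>(2, Twos)\<close>.\<close>
  then have XYZ: "measure lebesgue (?X \<union> ?Y \<union> ?Z)
      = 329 / 288 * ((1 / 81)\<^sup>2 / 9 + 2 * ((1 / 729)\<^sup>2 / 9))"
    using measure_right_gaps[of "62 / 81" "1 / 81" ?\<tau>] measure_right_gaps[of "512 / 729" "1 / 729" ?\<tau>]
      measure_right_gaps[of "674 / 729" "1 / 729" ?\<tau>] weights(2)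
    by (simp add: eval_nat_numeral)
  have "{4 / 9 .. 1} \<subseteq> products \<union> (root_gaps - (?X \<union> ?Y \<union> ?Z))"
    using complement_products X Y Z by blast
  moreover have pm: "products \<in> lmeasurable" using compact_products lmeasurable_compact by blast
  moreover have gm: "root_gaps - (?X \<union> ?Y \<union> ?Z) \<in> lmeasurable"
    using lmeasurable_root_gaps lm by (intro fmeasurable.Diff) (auto intro: fmeasurable.Un)
  ultimately have "measure lebesgue {4 / 9 .. 1 :: real}
      \<le> measure lebesgue (products \<union> (root_gaps - (?X \<union> ?Y \<union> ?Z)))"
    by (intro measure_mono_fmeasurable fmeasurable.Un) auto
  also have "\<dots> \<le> measure lebesgue products + measure lebesgue (root_gaps - (?X \<union> ?Y \<union> ?Z))"
    using pm gm by (intro measure_Un_le) (auto simp: fmeasurableD)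
  also have "measure lebesgue (root_gaps - (?X \<union> ?Y \<union> ?Z))
      = measure lebesgue root_gaps - measure lebesgue (?X \<union> ?Y \<union> ?Z)"
    using lmeasurable_root_gaps lm X Y Z
    by (intro measurable_measure_Diff) (auto intro: fmeasurable.Un simp: fmeasurableD)
  finally have "5 / 9 \<le> measure lebesgue products + weight (3, Fresh) / 9
      - 329 / 288 * ((1 / 81)\<^sup>2 / 9 + 2 * ((1 / 729)\<^sup>2 / 9))"
    unfolding XYZ measure_root_gaps by simp
  then show ?thesis unfolding weights by (simp add: power_divide)
qed

text \<open>Late gaps of the root and of its right child lie in \<open>?X\<close> and
  \<open>?Z\<close>. At the left child, with \<open>t = 1 / 729\<close>, the square of
  \<open>c + t / 3\<close> exceeds \<open>a * (a + 2 * s / 3)\<close>, so the criterion of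
  \<open>late_right_gaps\<close> fails; its whole subtree is left to \<open>late_cover\<close>,
  whose bound of about 46.9 units of \<open>1 / 170061120\<close> still fits the tolerance.\<close>

lemma measure_products_upper:
  "measure lebesgue products \<le> 91782456 / 170061120"
proof -
  let ?\<tau> = "(2, Twos)"
  let ?X = "right_gaps ?\<tau> (62 / 81) (1 / 81)"
  let ?Z = "right_gaps ?\<tau> (674 / 729) (1 / 729)"
  \<comment> \<open>\<open>\<beta>\<close> and \<open>\<gamma>\<close> bound the covers of nodes of
    length \<open>1 / 9\<close> and \<open>1 / 27\<close>; since
    \<open>(2 / 3) ^ 60 < 1 / 10 ^ 10\<close>, their geometric terms are negligible.
    \<open>\<xi>\<close> and \<open>\<zeta>\<close> are the measures of \<open>?X\<close> and
    \<open>?Z\<close>.\<close>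
  define \<beta> \<gamma> \<xi> \<zeta> :: real where
    "\<beta> = (1 / 9) ^ 4 / 553 + 2 * (1 / 9) * (2 / 3) ^ 60" and
    "\<gamma> = (1 / 27) ^ 4 / 553 + 2 * (1 / 27) * (2 / 3) ^ 60" and
    "\<xi> = 329 / 288 * ((1 / 81)\<^sup>2 / 9)" and
    "\<zeta> = 329 / 288 * ((1 / 729)\<^sup>2 / 9)"
  note bounds = this
  have cover: "\<exists>B\<in>lmeasurable. {z. occurs (late z) \<sigma> a s} \<subseteq> B
      \<and> measure lebesgue B \<le> s ^ 4 / 553 + 2 * s * (2 / 3) ^ 60"
    if "2 / 3 \<le> a" "s = 1 / 3 ^ (n + 1)" "a + s \<le> 1" for \<sigma> a s n
    using late_cover[OF that] .
  obtain B where B: "B \<in> lmeasurable" "{z. occurs (late z) (3, Zeros) (2 / 3) (1 / 9)} \<subseteq> B"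
    "measure lebesgue B \<le> \<beta>"
    using cover[of "2 / 3" "1 / 9" 1 "(3, Zeros)"] unfolding bounds by auto
  obtain C where C: "C \<in> lmeasurable" "{z. occurs (late z) (2, Fresh) (8 / 9) (1 / 27)} \<subseteq> C"
    "measure lebesgue C \<le> \<gamma>"
    using cover[of "8 / 9" "1 / 27" 2 "(2, Fresh)"] unfolding bounds by auto
  obtain E where E: "E \<in> lmeasurable" "{z. occurs (late z) (3, Twos) (26 / 27) (1 / 27)} \<subseteq> E"
    "measure lebesgue E \<le> \<gamma>"
    using cover[of "26 / 27" "1 / 27" 2 "(3, Twos)"] unfolding bounds by auto
  let ?U = "?X \<union> ?Z \<union> B \<union> C \<union> E"
  have lm: "?X \<in> lmeasurable" "?Z \<in> lmeasurable" by (auto intro: lmeasurable_right_gaps)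
  have X: "z \<in> ?X" if "late z (3, Fresh) (2 / 3) (1 / 3)" for z
  proof -
    have "(rchild ^^ 2) (lchild (3, Fresh)) = ?\<tau>" by (simp add: numeral_2_eq_2 numeral_3_eq_3)
    moreover have "z \<in> right_gaps ((rchild ^^ 2) (lchild (3, Fresh))) (62 / 81) (1 / 81)"
      by (rule late_right_gaps[OF that]) (simp_all add: power2_eq_square)
    ultimately show ?thesis by metis
  qed
  have Z: "z \<in> ?Z" if "late z (3, Twos) (8 / 9) (1 / 9)" for z
  proof -
    have "(rchild ^^ 3) (lchild (3, Twos)) = ?\<tau>" by (simp add: numeral_2_eq_2 numeral_3_eq_3)
    moreover have "z \<in> right_gaps ((rchild ^^ 3) (lchild (3, Twos))) (674 / 729) (1 / 729)"
      by (rule late_right_gaps[OF that]) (simp_all add: power2_eq_square)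
    ultimately show ?thesis by metis
  qed
  have "products \<inter> root_gaps \<subseteq> ?U"
  proof
    fix z assume "z \<in> products \<inter> root_gaps"
    then have "occurs (late z) (3, Fresh) (2 / 3) (1 / 3)" using products_in_gaps by blast
    then have "late z (3, Fresh) (2 / 3) (1 / 3) \<or> occurs (late z) (3, Zeros) (2 / 3) (1 / 9)
      \<or> occurs (late z) (3, Twos) (8 / 9) (1 / 9)"
      by (subst (asm) occurs_iff) (simp add: eval_nat_numeral)
    moreover have "late z (3, Twos) (8 / 9) (1 / 9) \<or> occurs (late z) (2, Fresh) (8 / 9) (1 / 27)
      \<or> occurs (late z) (3, Twos) (26 / 27) (1 / 27)" if "occurs (late z) (3, Twos) (8 / 9) (1 / 9)"
      using that by (subst (asm) occurs_iff) (simp add: eval_nat_numeral)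
    ultimately show "z \<in> ?U" using X Z B(2) C(2) E(2) by blast
  qed
  then have sub: "products \<subseteq> ({4 / 9 .. 1} - root_gaps) \<union> ?U" using products_subset by blast
  have U: "?U \<in> lmeasurable" using lm B(1) C(1) E(1) by (intro fmeasurable.Un)
  have "measure lebesgue ?U \<le> measure lebesgue ?X + measure lebesgue ?Z + measure lebesgue B
      + measure lebesgue C + measure lebesgue E"
    using lm B(1) C(1) E(1) measure_Un_le[of ?X lebesgue ?Z] measure_Un_le[of "?X \<union> ?Z" lebesgue B]
      measure_Un_le[of "?X \<union> ?Z \<union> B" lebesgue C] measure_Un_le[of "?X \<union> ?Z \<union> B \<union> C" lebesgue E]
    by (simp add: fmeasurableD)
  moreover have "measure lebesgue ?X = \<xi>" "measure lebesgue ?Z = \<zeta>"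
    using measure_right_gaps[of "62 / 81" "1 / 81" ?\<tau>] measure_right_gaps[of "674 / 729" "1 / 729" ?\<tau>]
      weights(2) unfolding bounds by (simp_all add: eval_nat_numeral)
  moreover have dm: "{4 / 9 .. 1} - root_gaps \<in> lmeasurable"
    using lmeasurable_root_gaps by (intro fmeasurable.Diff) (auto simp: fmeasurableD)
  moreover have "measure lebesgue products \<le> measure lebesgue (({4 / 9 .. 1} - root_gaps) \<union> ?U)"
    by (rule measure_mono_fmeasurable[OF sub _ fmeasurable.Un[OF dm U]])
      (rule fmeasurableD[OF lmeasurable_compact[OF compact_products]])
  moreover have "\<dots> \<le> measure lebesgue ({4 / 9 .. 1} - root_gaps) + measure lebesgue ?U"
    using dm U by (intro measure_Un_le) (auto simp: fmeasurableD)
  moreover have "measure lebesgue ({4 / 9 .. 1} - root_gaps) = 5 / 9 - weight (3, Fresh) / 9"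
    using lmeasurable_root_gaps root_gaps_subset
    by (subst measurable_measure_Diff) (auto simp: fmeasurableD measure_root_gaps)
  ultimately have "measure lebesgue products \<le> 5 / 9 - weight (3, Fresh) / 9 + \<xi> + \<zeta> + \<beta> + 2 * \<gamma>"
    using B(3) C(3) E(3) by linarith
  also have "\<dots> \<le> 91782456 / 170061120"
    unfolding weights bounds by (simp add: power_divide)
  finally show ?thesis .
qed

theorem proposition1p3:
  fixes P :: "real \<times> real \<Rightarrow> real"
  assumes "\<And>x y. P (x, y) = x * y"
  shows "\<bar>measure lebesgue (P ` (fast_subdivision 3 \<times> fast_subdivision 3))
            - 91782451 / 170061120\<bar> \<le> 1 / (64 * 9 ^ 6)"
proof -
  have "P ` (fast_subdivision 3 \<times> fast_subdivision 3) = products"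
    unfolding products_def by (intro image_cong) (auto simp: assms)
  \<comment> \<open>The tolerance is five units of the common denominator, whence the numerators
    91782446 and 91782456 of the two bounds.\<close>
  moreover have "1 / (64 * 9 ^ 6) = 5 / (170061120 :: real)" by simp
  ultimately show ?thesis using measure_products_lower measure_products_upper
    by (simp only: abs_le_iff) linarith
qed

end
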